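(* Assume that $\mathbf{E}[(\min\{0,X^{(0)}\})^2]<\infty$ and $\mathbf{P}(X^{(0)}>u)=u^{-r}L(u)$ with $r\in(1,2)$, where $L$ is slowly varying at infinity. If $$\liminf_{a\to0}g(a)x_a=\infty,$$ then $$\mathbf{P}(M^{(a)}>x_a)\sim\frac{x_a^{-r+1}L(x_a)}{(r-1)a}\quad\text{as }a\to0.$$
   Context: $X^{(0)}$ is a real random variable with $\mathbf{E}[X^{(0)}]=0$, and for $a>0$, $X^{(a)}:=X^{(0)}-a$, so $\mathbf{E}[X^{(a)}]=-a$. For each $a>0$, $S^{(a)}_n$ ($n\ge0$, $S^{(a)}_0=0$) is the random walk whose increments are independent copies of $X^{(a)}$, and $M^{(a)}:=\max_{n\ge0}S^{(a)}_n$. $(x_a)_{a>0}$ is a family of positive numbers; $a\to0$ means $a\downarrow0$; $f(a)\sim h(a)$ means $f(a)/h(a)\to1$. The function $g$ is the heavy-traffic normalization, a regularly varying function for which $g(a)M^{(a)}$ converges weakly as $a\to0$. It is defined as follows: let $(c_n)$ be a sequence of positive numbers tending to infinity with $c_n^{-r}L(c_n)\sim 1/n$ as $n\to\infty$ (then $S^{(0)}_n/c_n$, where $S^{(0)}$ is the random walk with increments distributed as $X^{(0)}$, converges weakly to a stable law of index $r$); let $n_a$ be positive integers with $n_a\to\infty$ and $a n_a\sim c_{n_a}$ as $a\to0$; then $g(a):=1/c_{n_a}$. *)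

theory Defs
  imports "HOL-Probability.Probability" "HOL-Library.Landau_Symbols"
begin

text \<open>Slow variation at infinity in the sense of Karamata: \<open>L\<close> only needs to be positive and
  Borel measurable on some half-line, and its values elsewhere are irrelevant.\<close>

definition slowly_varying :: "(real \<Rightarrow> real) \<Rightarrow> bool" where
  "slowly_varying L \<longleftrightarrow>
     (\<exists>A. L \<in> borel_measurable (restrict_space borel {A..}) \<and> (\<forall>u\<ge>A. L u > 0)) \<and>
     (\<forall>t>0. ((\<lambda>u. L (t * u) / L u) \<longlongrightarrow> 1) at_top)"

definition iid_copies :: "'w measure \<Rightarrow> (nat \<Rightarrow> 'w \<Rightarrow> real) \<Rightarrow> 'v measure \<Rightarrow> ('v \<Rightarrow> real) \<Rightarrow> bool" where
  "iid_copies P \<xi> N X \<longleftrightarrow>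
     prob_space P \<and> prob_space.indep_vars P (\<lambda>_. borel) \<xi> UNIV \<and>
     (\<forall>k. distr P borel (\<xi> k) = distr N borel X)"

definition random_walk :: "(nat \<Rightarrow> 'w \<Rightarrow> real) \<Rightarrow> nat \<Rightarrow> 'w \<Rightarrow> real" where
  "random_walk \<xi> n \<omega> = (\<Sum>k<n. \<xi> k \<omega>)"

text \<open>The maximum is taken in the extended reals, so that it is \<open>\<infinity>\<close> on the paths (a null set when
  the drift is negative) along which the walk is unbounded above; a supremum in \<open>real\<close> would have
  an unspecified value there.\<close>

definition walk_max :: "(nat \<Rightarrow> 'w \<Rightarrow> real) \<Rightarrow> 'w \<Rightarrow> ereal" where
  "walk_max \<xi> \<omega> = (SUP n. ereal (random_walk \<xi> n \<omega>))"

end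

theory Submission
  imports Defs "HOL-Real_Asymp.Real_Asymp"
begin

text \<open>Write \<open>T(u)\<close> for the tail of the law of the centred increment and
  \<open>I(y) = E (X - y)\<^sup>+\<close> for the integrated tail. By Karamata's theorem \<open>I(x)\<close> is asymptotic to
  \<open>x T(x) / (r - 1)\<close>, so the claim says that the crossing probability is asymptotic to
  \<open>I(x) / a\<close>. Both bounds come from evaluating at time \<open>0\<close> a function of the distance \<open>y\<close>
  between the walk and a level: \<open>x\<close> for the upper bound, \<open>x + R\<close> for the lower one.

  Lower bound: as \<open>I\<close> is convex with one-sided derivative \<open>-T\<close>, the function
  \<open>(1 - \<epsilon>) I(y) / a\<close>, replaced by \<open>1\<close> once \<open>y < R\<close>, where \<open>R\<close> is large on
  the scale \<open>1 / g(a)\<close> but small compared with \<open>x\<close>, is a submartingale: the drift costs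
  \<open>(1 - \<epsilon>) T(y)\<close> per step and the jumps over the whole distance gain \<open>T(y)\<close>.

  Upper bound: with \<open>J = K / a\<close>, where \<open>K \<le> I\<close> is a smoothed version of \<open>I\<close>, the function
  \<open>min 1 ((1 + \<epsilon>) J + C J\<^sup>2)\<close> is a supermartingale when \<open>C\<close> is large. The term \<open>C J\<^sup>2\<close>
  is negligible at the starting point, but its drift gain \<open>2 C J T\<close> pays for the second-order
  terms and the moderately large jumps, whose costs are both of order \<open>J T\<close>.\<close>

section \<open>Harmonic bounds for the maximum of a random walk\<close>

text \<open>Freezing at the first passage above \<open>x\<close> makes the event of having crossed
  by time \<open>n\<close> a function of the position at time \<open>n\<close>, so that one-step
  expectations and induction over \<open>n\<close> replace optional stopping.\<close>

primrec stopped_walk :: "real \<Rightarrow> (nat \<Rightarrow> 'w \<Rightarrow> real) \<Rightarrow> nat \<Rightarrow> 'w \<Rightarrow> real" where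
  "stopped_walk x \<xi> 0 \<omega> = 0"
| "stopped_walk x \<xi> (Suc n) \<omega> =
     (if x < stopped_walk x \<xi> n \<omega> then stopped_walk x \<xi> n \<omega> else stopped_walk x \<xi> n \<omega> + \<xi> n \<omega>)"

lemma less_stopped_walk_iff:
  "(x < stopped_walk x \<xi> n \<omega> \<longleftrightarrow> (\<exists>k\<le>n. x < random_walk \<xi> k \<omega>)) \<and>
   (\<not> x < stopped_walk x \<xi> n \<omega> \<longrightarrow> stopped_walk x \<xi> n \<omega> = random_walk \<xi> n \<omega>)"
proof (induction n)
  case 0
  then show ?case by (auto simp: random_walk_def)
next
  case (Suc n)
  show ?case
  proof (cases "x < stopped_walk x \<xi> n \<omega>")
    case True
    then show ?thesis using Suc by (auto intro: le_SucI)
  next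
    case False
    have "random_walk \<xi> (Suc n) \<omega> = random_walk \<xi> n \<omega> + \<xi> n \<omega>"
      by (simp add: random_walk_def)
    then show ?thesis using Suc False by (auto simp: le_Suc_eq)
  qed
qed

lemma less_walk_max_iff:
  "ereal x < walk_max \<xi> \<omega> \<longleftrightarrow> (\<exists>n. x < stopped_walk x \<xi> n \<omega>)"
  unfolding walk_max_def less_SUP_iff less_stopped_walk_iff[THEN conjunct1] by auto

text \<open>Writing the position at time \<open>n\<close> as a function of a finite block of
  increments gives the form in which independence of blocks applies.\<close>

lemma stopped_walk_restrict:
  "n \<le> m \<Longrightarrow> stopped_walk x (\<lambda>i f. f i) n (restrict (\<lambda>i. \<xi> i \<omega>) {..<m}) = stopped_walk x \<xi> n \<omega>"
  by (induction n) auto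

lemma measurable_stopped_walk:
  assumes "\<And>k. k < n \<Longrightarrow> \<xi> k \<in> borel_measurable M"
  shows "stopped_walk x \<xi> n \<in> borel_measurable M"
  using assms
proof (induction n)
  case (Suc n)
  have [measurable]: "stopped_walk x \<xi> n \<in> borel_measurable M" "\<xi> n \<in> borel_measurable M"
    using Suc by auto
  show ?case
    by (subst measurable_cong[OF stopped_walk.simps(2)]) measurable
qed (subst measurable_cong[OF stopped_walk.simps(1)], simp)

section \<open>Markov property of the stopped walk\<close>

locale walk_with_step_law = prob_space P for P :: "'w measure" +
  fixes \<xi> :: "nat \<Rightarrow> 'w \<Rightarrow> real" and G :: "real measure"
  assumes indep: "indep_vars (\<lambda>_. borel) \<xi> UNIV"
    and law: "\<And>k. distr P borel (\<xi> k) = G"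
begin

lemma random_variable_step [measurable]: "\<xi> k \<in> borel_measurable P"
  using indep by (auto simp: indep_vars_def)

lemma sets_step_law [measurable_cong]: "sets G = sets borel"
  unfolding law[of 0, symmetric] by simp

lemma prob_space_step_law: "prob_space G"
  unfolding law[of 0, symmetric] by (rule prob_space_distr) simp

lemma measurable_stopped [measurable]: "stopped_walk x \<xi> n \<in> borel_measurable P"
  by (rule measurable_stopped_walk) simp

text \<open>The position at time \<open>n\<close> uses only increments with index below
  \<open>n\<close>, and these indices are disjoint from \<open>{n}\<close>.\<close>

lemma indep_stopped_step: "indep_var borel (stopped_walk x \<xi> n) borel (\<xi> n)"
proof -
  have *: "stopped_walk x (\<lambda>i f. f i) n \<in> borel_measurable (PiM {..<n} (\<lambda>_. borel))"
    by (rule measurable_stopped_walk) auto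
  have "indep_var borel (stopped_walk x (\<lambda>i f. f i) n \<circ> (\<lambda>\<omega>. restrict (\<lambda>i. \<xi> i \<omega>) {..<n}))
      borel ((\<lambda>f. f n) \<circ> (\<lambda>\<omega>. restrict (\<lambda>i. \<xi> i \<omega>) {n}))"
    by (rule indep_var_compose[OF indep_var_restrict[OF indep, of "{..<n}" "{n}"] *]) auto
  moreover have "stopped_walk x (\<lambda>i f. f i) n \<circ> (\<lambda>\<omega>. restrict (\<lambda>i. \<xi> i \<omega>) {..<n}) = stopped_walk x \<xi> n"
    by (auto simp: stopped_walk_restrict)
  moreover have "(\<lambda>f. f n) \<circ> (\<lambda>\<omega>. restrict (\<lambda>i. \<xi> i \<omega>) {n}) = \<xi> n"
    by auto
  ultimately show ?thesis by simp
qed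

lemma integrable_stopped:
  fixes f :: "real \<Rightarrow> real"
  assumes [measurable]: "f \<in> borel_measurable borel" and "\<And>s. \<bar>f s\<bar> \<le> B"
  shows "integrable P (\<lambda>\<omega>. f (stopped_walk x \<xi> n \<omega>))"
  by (rule integrable_const_bound[where B=B]) (use assms in auto)

text \<open>By independence the position and the next increment have a product law, and Fubini
  integrates out the increment. Boundedness of \<open>f\<close> supplies integrability.\<close>

lemma expectation_stopped_Suc:
  fixes f :: "real \<Rightarrow> real"
  assumes [measurable]: "f \<in> borel_measurable borel" and bd: "\<And>s. \<bar>f s\<bar> \<le> B"
  shows "expectation (\<lambda>\<omega>. f (stopped_walk x \<xi> (Suc n) \<omega>)) =
    expectation (\<lambda>\<omega>. if x < stopped_walk x \<xi> n \<omega> then f (stopped_walk x \<xi> n \<omega>)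
       else \<integral>t. f (stopped_walk x \<xi> n \<omega> + t) \<partial>G)"
proof -
  let ?Y = "stopped_walk x \<xi> n"
  let ?D = "distr P borel ?Y"
  define h where "h = (\<lambda>(y, t). if x < y then f y else f (y + t))"
  have h[measurable]: "h \<in> borel_measurable (borel \<Otimes>\<^sub>M borel)"
    unfolding h_def by measurable
  interpret D: prob_space ?D by (rule prob_space_distr) simp
  interpret G: prob_space G by (rule prob_space_step_law)
  interpret DG: pair_prob_space ?D G ..
  have joint: "?D \<Otimes>\<^sub>M G = distr P (borel \<Otimes>\<^sub>M borel) (\<lambda>\<omega>. (?Y \<omega>, \<xi> n \<omega>))"
    using indep_stopped_step[of x n] unfolding indep_var_distribution_eq law by simp
  have int: "integrable (?D \<Otimes>\<^sub>M G) h"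
    by (rule DG.integrable_const_bound[where B=B]) (auto simp: h_def bd)
  have "expectation (\<lambda>\<omega>. f (stopped_walk x \<xi> (Suc n) \<omega>)) = expectation (\<lambda>\<omega>. h (?Y \<omega>, \<xi> n \<omega>))"
    by (auto simp: h_def intro!: Bochner_Integration.integral_cong)
  also have "\<dots> = integral\<^sup>L (?D \<Otimes>\<^sub>M G) h"
    unfolding joint by (rule integral_distr[symmetric]) auto
  also have "\<dots> = (\<integral>y. (\<integral>t. h (y, t) \<partial>G) \<partial>?D)"
    by (rule DG.integral_fst'[OF int, symmetric])
  also have "\<dots> = expectation (\<lambda>\<omega>. \<integral>t. h (?Y \<omega>, t) \<partial>G)"
    by (rule integral_distr) auto
  also have "\<dots> = expectation (\<lambda>\<omega>. if x < ?Y \<omega> then f (?Y \<omega>) else \<integral>t. f (?Y \<omega> + t) \<partial>G)"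
    by (rule Bochner_Integration.integral_cong) (auto simp: h_def G.prob_space)
  finally show ?thesis .
qed

lemma tendsto_prob_stopped:
  "(\<lambda>n. prob {\<omega> \<in> space P. x < stopped_walk x \<xi> n \<omega>}) \<longlonglongrightarrow> prob {\<omega> \<in> space P. walk_max \<xi> \<omega> > ereal x}"
proof -
  have "incseq (\<lambda>n. {\<omega> \<in> space P. x < stopped_walk x \<xi> n \<omega>})"
    by (auto simp: incseq_Suc_iff)
  then have "(\<lambda>n. prob {\<omega> \<in> space P. x < stopped_walk x \<xi> n \<omega>})
      \<longlonglongrightarrow> prob (\<Union>n. {\<omega> \<in> space P. x < stopped_walk x \<xi> n \<omega>})"
    by (intro finite_Lim_measure_incseq) auto
  also have "(\<Union>n. {\<omega> \<in> space P. x < stopped_walk x \<xi> n \<omega>}) = {\<omega> \<in> space P. walk_max \<xi> \<omega> > ereal x}"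
    by (auto simp: less_walk_max_iff)
  finally show ?thesis .
qed

lemma prob_stopped:
  "prob {\<omega> \<in> space P. x < stopped_walk x \<xi> n \<omega>} =
     expectation (\<lambda>\<omega>. indicator {x<..} (stopped_walk x \<xi> n \<omega>))"
proof -
  have "expectation (\<lambda>\<omega>. indicator {x<..} (stopped_walk x \<xi> n \<omega>) :: real) =
      expectation (indicator {\<omega> \<in> space P. x < stopped_walk x \<xi> n \<omega>})"
    by (rule Bochner_Integration.integral_cong) (auto simp: indicator_def)
  then show ?thesis by simp
qed

lemma measurable_transition [measurable]:
  fixes f :: "real \<Rightarrow> real"
  assumes [measurable]: "f \<in> borel_measurable borel"
  shows "(\<lambda>s. \<integral>t. f (s + t) \<partial>G) \<in> borel_measurable borel"
proof -
  interpret G: prob_space G by (rule prob_space_step_law)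
  show ?thesis by measurable
qed

lemma abs_transition_le:
  fixes f :: "real \<Rightarrow> real"
  assumes [measurable]: "f \<in> borel_measurable borel" and bd: "\<And>s. \<bar>f s\<bar> \<le> B"
  shows "\<bar>\<integral>t. f (s + t) \<partial>G\<bar> \<le> B"
proof -
  interpret G: prob_space G by (rule prob_space_step_law)
  have "norm (\<integral>t. f (s + t) \<partial>G) \<le> (\<integral>t. norm (f (s + t)) \<partial>G)"
    by (rule integral_norm_bound)
  also have "\<dots> \<le> B"
    using bd by (intro G.integral_le_const G.integrable_const_bound[where B=B]) auto
  finally show ?thesis by simp
qed

text \<open>The expectation of \<open>W\<close> along the stopped walk starts at \<open>W 0\<close>
  and cannot increase. It dominates the probability of having crossed by time \<open>n\<close>,
  because \<open>W\<close> is 1 above \<open>x\<close>; then \<open>n\<close> tends to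
  infinity.\<close>

proposition prob_walk_max_le_superharmonic:
  assumes W[measurable]: "W \<in> borel_measurable borel"
    and W01: "\<And>s. 0 \<le> W s" "\<And>s. W s \<le> 1"
    and W1: "\<And>s. x < s \<Longrightarrow> W s = 1"
    and step: "\<And>s. s \<le> x \<Longrightarrow> (\<integral>t. W (s + t) \<partial>G) \<le> W s"
  shows "prob {\<omega> \<in> space P. walk_max \<xi> \<omega> > ereal x} \<le> W 0"
proof (rule LIMSEQ_le_const2[OF tendsto_prob_stopped], intro exI allI impI)
  fix n :: nat
  have bd: "\<bar>W s\<bar> \<le> 1" for s using W01[of s] by simp
  note int = integrable_stopped[OF W bd]
  have "expectation (\<lambda>\<omega>. W (stopped_walk x \<xi> n \<omega>)) \<le> W 0"
  proof (induction n)
    case 0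
    then show ?case by (simp add: prob_space)
  next
    case (Suc n)
    have "expectation (\<lambda>\<omega>. W (stopped_walk x \<xi> (Suc n) \<omega>))
        \<le> expectation (\<lambda>\<omega>. W (stopped_walk x \<xi> n \<omega>))"
      unfolding expectation_stopped_Suc[OF W bd]
      by (intro integral_mono int integrable_const_bound[where B=1])
        (auto intro!: AE_I2 simp: bd step abs_transition_le[OF W bd])
    with Suc show ?case by simp
  qed
  moreover have "prob {\<omega> \<in> space P. x < stopped_walk x \<xi> n \<omega>} \<le> expectation (\<lambda>\<omega>. W (stopped_walk x \<xi> n \<omega>))"
    unfolding prob_stopped
    by (intro integral_mono int integrable_stopped[where B=1])
      (auto simp: indicator_def W1 W01)
  ultimately show "prob {\<omega> \<in> space P. x < stopped_walk x \<xi> n \<omega>} \<le> W 0" by simp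
qed

text \<open>The gain \<open>V\<close> is summable along the stopped walk; by the last hypothesis this forces
  \<open>W\<close> to vanish on the paths that are not stopped.\<close>

proposition prob_walk_max_ge_subharmonic:
  assumes W[measurable]: "W \<in> borel_measurable borel" and V[measurable]: "V \<in> borel_measurable borel"
    and W01: "\<And>s. 0 \<le> W s" "\<And>s. W s \<le> 1"
    and V01: "\<And>s. 0 \<le> V s" "\<And>s. V s \<le> 1"
    and step: "\<And>s. s \<le> x \<Longrightarrow> W s + V s \<le> (\<integral>t. W (s + t) \<partial>G)"
    and small: "\<And>e. e > 0 \<Longrightarrow> \<exists>B\<ge>0. \<forall>s\<le>x. W s \<le> e + B * V s"
  shows "W 0 \<le> prob {\<omega> \<in> space P. walk_max \<xi> \<omega> > ereal x}"
proof -
  \<comment> \<open>A frozen path makes no further gain, hence the cut-off of \<open>V\<close> above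
    \<open>x\<close>.\<close>
  define V' where "V' s = (if x < s then 0 else V s)" for s
  have V'[measurable]: "V' \<in> borel_measurable borel" unfolding V'_def by measurable
  have bd: "\<bar>W s\<bar> \<le> 1" "\<bar>V' s\<bar> \<le> 1" for s using W01[of s] V01[of s] by (auto simp: V'_def)
  note intW = integrable_stopped[OF W bd(1)] and intV = integrable_stopped[OF V' bd(2)]
  define w where "w n = expectation (\<lambda>\<omega>. W (stopped_walk x \<xi> n \<omega>))" for n
  define v where "v n = expectation (\<lambda>\<omega>. V' (stopped_walk x \<xi> n \<omega>))" for n
  define p where "p n = prob {\<omega> \<in> space P. x < stopped_walk x \<xi> n \<omega>}" for n
  have v0: "v n \<ge> 0" for n
    unfolding v_def by (rule integral_nonneg_AE) (auto simp: V'_def V01)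
  have incr: "w n + v n \<le> w (Suc n)" for n
    unfolding w_def v_def expectation_stopped_Suc[OF W bd(1)]
      Bochner_Integration.integral_add[OF intW intV, symmetric]
    by (intro integral_mono Bochner_Integration.integrable_add intW intV integrable_const_bound[where B=1])
      (auto intro!: AE_I2 simp: bd V'_def step abs_transition_le[OF W bd(1)])
  have w_le: "w n \<le> 1" for n
    unfolding w_def by (rule integral_le_const) (auto simp: W01 intW)
  have w_sum: "w 0 + (\<Sum>k<n. v k) \<le> w n" for n
  proof (induction n)
    case (Suc n)
    then show ?case using incr[of n] by simp
  qed simp
  have "w 0 = W 0" by (simp add: w_def prob_space)
  \<comment> \<open>The gains add up to at most the total increase of \<open>w\<close>, which stays
    between 0 and 1.\<close>
  have "summable v"
  proof (rule summableI_nonneg_bounded[where x = 1])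
    show "(\<Sum>k<n. v k) \<le> 1" for n
      using w_sum[of n] w_le[of n] \<open>w 0 = W 0\<close> W01(1)[of 0] by simp
  qed (rule v0)
  then have v_lim: "v \<longlonglongrightarrow> 0" by (rule summable_LIMSEQ_zero)
  have "W 0 \<le> prob {\<omega> \<in> space P. walk_max \<xi> \<omega> > ereal x} + e" if "e > 0" for e
  proof -
    obtain B where B: "B \<ge> 0" "\<forall>s\<le>x. W s \<le> e + B * V s" using small[OF \<open>e > 0\<close>] by blast
    \<comment> \<open>Crossed paths are paid for by the indicator, since \<open>W\<close> is at most
      1. On the others \<open>small\<close> trades \<open>W\<close> for \<open>e\<close> and a
      multiple of the gain, whose expectation \<open>v n\<close> vanishes in the limit.\<close>
    have "W 0 \<le> p n + (e + B * v n)" for n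
    proof -
      have int1: "integrable P (\<lambda>\<omega>. indicat_real {x<..} (stopped_walk x \<xi> n \<omega>))"
        by (rule integrable_stopped[where B=1]) (auto simp: indicator_def)
      have int2: "integrable P (\<lambda>\<omega>. e + B * V' (stopped_walk x \<xi> n \<omega>))"
        using intV by simp
      have "W 0 \<le> w n"
        using w_sum[of n] sum_nonneg[of "{..<n}" v] v0 \<open>w 0 = W 0\<close> by fastforce
      also have "\<dots> \<le> expectation (\<lambda>\<omega>. indicator {x<..} (stopped_walk x \<xi> n \<omega>)
          + (e + B * V' (stopped_walk x \<xi> n \<omega>)))"
        unfolding w_def
      proof (rule integral_mono[OF intW Bochner_Integration.integrable_add[OF int1 int2]])
        fix \<omega>
        let ?y = "stopped_walk x \<xi> n \<omega>"
        show "W ?y \<le> indicator {x<..} ?y + (e + B * V' ?y)"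
          using B W01(2)[of ?y] \<open>e > 0\<close> by (cases "x < ?y") (auto simp: V'_def)
      qed
      also have "\<dots> = p n + (e + B * v n)"
        unfolding p_def prob_stopped v_def Bochner_Integration.integral_add[OF int1 int2]
        using intV by (simp add: prob_space)
      finally show ?thesis .
    qed
    moreover have "(\<lambda>n. p n + (e + B * v n)) \<longlonglongrightarrow> prob {\<omega> \<in> space P. walk_max \<xi> \<omega> > ereal x} + (e + B * 0)"
      unfolding p_def by (intro tendsto_intros tendsto_prob_stopped v_lim)
    ultimately show ?thesis by (intro LIMSEQ_le_const) auto
  qed
  then show ?thesis by (rule field_le_epsilon)
qed

end

section \<open>Regularly varying tails\<close>

text \<open>Repeated halving brings any \<open>z\<close> above \<open>z0\<close> into the interval
  from \<open>z0\<close> to \<open>2 * z0\<close>. This turns tail ratio bounds at factor 2 into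
  bounds on a whole half-line.\<close>

lemma dyadic_induct:
  fixes z0 :: real
  assumes "z0 > 0" "z0 \<le> z"
    and base: "\<And>z. z0 \<le> z \<Longrightarrow> z \<le> 2 * z0 \<Longrightarrow> Q z"
    and step: "\<And>z. z0 \<le> z \<Longrightarrow> Q z \<Longrightarrow> Q (2 * z)"
  shows "Q z"
proof -
  have *: "Q z" if "z0 \<le> z" "z \<le> 2 ^ k * z0" for k z
    using that
  proof (induction k arbitrary: z)
    case 0
    then show ?case using base[of z] \<open>z0 > 0\<close> by simp
  next
    case (Suc k)
    show ?case
    proof (cases "z \<le> 2 * z0")
      case True
      then show ?thesis using base Suc by simp
    next
      case False
      then have "Q (z / 2)" using Suc by simp
      with False show ?thesis using step[of "z / 2"] by simp
    qed
  qed
  obtain k :: nat where "z / z0 < 2 ^ k" using real_arch_pow[of 2 "z / z0"] by auto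
  then have "z \<le> 2 ^ k * z0" using \<open>z0 > 0\<close> by (simp add: field_simps)
  then show ?thesis by (rule *[OF assms(2)])
qed

text \<open>Regular variation is stated through ratios of tails, the form in which it is iterated
  along geometric sequences.\<close>

locale regularly_varying_law = prob_space F for F :: "real measure" +
  fixes r :: real
  assumes sets_F [measurable_cong]: "sets F = sets borel"
    and integrable_id: "integrable F (\<lambda>u. u)"
    and mean_zero: "expectation (\<lambda>u. u) = 0"
    and integrable_neg_part: "integrable F (\<lambda>u. (min 0 u)\<^sup>2)"
    and r_gt_1: "1 < r" and r_less_2: "r < 2"
    and tail_pos': "\<And>u. 0 < prob {u<..}"
    and tail_ratio': "\<And>t. t > 0 \<Longrightarrow> ((\<lambda>u. prob {t * u<..} / prob {u<..}) \<longlongrightarrow> t powr (- r)) at_top"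
begin

section \<open>Integrated tail and Karamata's theorem\<close>

definition T :: "real \<Rightarrow> real" where "T u = prob {u<..}"

definition I :: "real \<Rightarrow> real" where "I y = expectation (\<lambda>u. max 0 (u - y))"

lemma space_F [simp]: "space F = UNIV"
  using sets_eq_imp_space_eq[OF sets_F] by simp

lemma T_pos: "0 < T u" and T_nonneg [simp]: "0 \<le> T u" and T_le_1: "T u \<le> 1"
  using tail_pos'[of u] by (auto simp: T_def)

lemma T_antimono: "u \<le> v \<Longrightarrow> T v \<le> T u"
  unfolding T_def by (rule finite_measure_mono) auto

lemma measurable_T [measurable]: "T \<in> borel_measurable borel"
proof -
  have "mono (\<lambda>y. - T y)" by (auto simp: mono_def T_antimono)
  from borel_measurable_uminus[OF borel_measurable_mono[OF this]] show ?thesis by simp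
qed

lemma integrable_indicator_real [simp]: "integrable F (indicat_real {u<..})"
  by (rule integrable_const_bound[where B=1]) auto

lemma eventually_T_le:
  assumes "t > 0" "t powr (- r) < B"
  shows "\<forall>\<^sub>F u in at_top. T (t * u) \<le> B * T u"
  using order_tendstoD(2)[OF tail_ratio'[OF assms(1)] assms(2)]
  by eventually_elim (use T_pos in \<open>simp add: T_def[symmetric] field_simps\<close>)

lemma eventually_T_ge:
  assumes "t > 0" "B < t powr (- r)"
  shows "\<forall>\<^sub>F u in at_top. B * T u \<le> T (t * u)"
  using order_tendstoD(1)[OF tail_ratio'[OF assms(1)] assms(2)]
  by eventually_elim (use T_pos in \<open>simp add: T_def[symmetric] field_simps\<close>)

lemma integrable_pos_part [simp]: "integrable F (\<lambda>u. max 0 (u - y))"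
  by (rule Bochner_Integration.integrable_bound[where f = "\<lambda>u. \<bar>u\<bar> + \<bar>y\<bar>"]) (auto intro!: integrable_id)

lemma I_nonneg [simp]: "0 \<le> I y"
  unfolding I_def by (rule integral_nonneg_AE) auto

lemma I_antimono: "y \<le> z \<Longrightarrow> I z \<le> I y"
  unfolding I_def by (rule integral_mono) auto

lemma measurable_I [measurable]: "I \<in> borel_measurable borel"
proof -
  have "mono (\<lambda>y. - I y)" by (auto simp: mono_def I_antimono)
  from borel_measurable_uminus[OF borel_measurable_mono[OF this]] show ?thesis by simp
qed

text \<open>The difference of the hinge functions with kinks at \<open>y\<close> and
  \<open>z\<close> lies between \<open>z - y\<close> times the indicators of \<open>{z<..}\<close>
  and of \<open>{y<..}\<close>; the upper half gives this bound, the lower half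
  \<open>I_diff_ge\<close>.\<close>

lemma I_diff_le: "y \<le> z \<Longrightarrow> I y \<le> I z + (z - y) * T y"
proof -
  assume "y \<le> z"
  have "I y \<le> expectation (\<lambda>u. max 0 (u - z) + (z - y) * indicator {y<..} u)"
    unfolding I_def using \<open>y \<le> z\<close>
    by (intro integral_mono Bochner_Integration.integrable_add integrable_mult_right
        integrable_pos_part integrable_indicator_real) (auto simp: indicator_def)
  also have "\<dots> = I z + (z - y) * T y"
    by (simp add: I_def T_def)
  finally show ?thesis .
qed

lemma I_diff_ge: "y \<le> z \<Longrightarrow> I z + (z - y) * T z \<le> I y"
proof -
  assume "y \<le> z"
  have "I z + (z - y) * T z = expectation (\<lambda>u. max 0 (u - z) + (z - y) * indicator {z<..} u)"
    by (simp add: I_def T_def)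
  also have "\<dots> \<le> I y"
    unfolding I_def using \<open>y \<le> z\<close>
    by (intro integral_mono Bochner_Integration.integrable_add integrable_mult_right
        integrable_pos_part integrable_indicator_real) (auto simp: indicator_def)
  finally show ?thesis .
qed

text \<open>The hinge \<open>max 0 (u - y)\<close>, as a convex function of its kink, lies above its
  tangents, whose slopes are given by an indicator; integration preserves this for \<open>t\<close>
  of either sign.\<close>

lemma I_tangent: "I y + t * T y \<le> I (y - t)"
proof -
  have "I y + t * T y = expectation (\<lambda>u. max 0 (u - y) + t * indicator {y<..} u)"
    by (simp add: I_def T_def)
  also have "\<dots> \<le> I (y - t)"
    unfolding I_def
    by (intro integral_mono Bochner_Integration.integrable_add integrable_mult_right
        integrable_pos_part integrable_indicator_real) (auto simp: indicator_def)
  finally show ?thesis .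
qed

lemma integral_tail_eq: "expectation (\<lambda>u. u * indicator {y<..} u) = y * T y + I y"
proof -
  have "expectation (\<lambda>u. u * indicator {y<..} u) = expectation (\<lambda>u. y * indicator {y<..} u + max 0 (u - y))"
    by (rule Bochner_Integration.integral_cong) (auto simp: indicator_def)
  then show ?thesis by (simp add: I_def T_def)
qed

lemma I_tendsto_0: "(I \<longlongrightarrow> 0) at_top"
proof -
  have "((\<lambda>y. expectation (\<lambda>u. max 0 (u - y))) \<longlongrightarrow> expectation (\<lambda>u. 0)) at_top"
  proof (rule integral_dominated_convergence_at_top[where w = "\<lambda>u. \<bar>u\<bar>"])
    show "AE u in F. ((\<lambda>y. max 0 (u - y)) \<longlongrightarrow> 0) at_top"
    proof (rule AE_I2)
      fix u :: real
      have "\<forall>\<^sub>F y in at_top. max 0 (u - y) = 0"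
        using eventually_ge_at_top[of u] by eventually_elim simp
      then show "((\<lambda>y. max 0 (u - y)) \<longlongrightarrow> 0) at_top" by (rule tendsto_eventually)
    qed
    show "\<forall>\<^sub>F y in at_top. AE u in F. norm (max 0 (u - y)) \<le> \<bar>u\<bar>"
      using eventually_ge_at_top[of 0] by eventually_elim auto
  qed (auto intro!: integrable_id)
  then show ?thesis by (simp add: I_def[abs_def])
qed

lemma mult_T_le_I: "z * T z \<le> 2 * I (z / 2)" if "z \<ge> 0"
  using I_diff_ge[of "z/2" z] I_nonneg[of z] that by (auto simp: field_simps simp del: I_nonneg)

lemma mult_T_tendsto_0: "((\<lambda>z. z * T z) \<longlongrightarrow> 0) at_top"
proof (rule tendsto_sandwich)
  show "((\<lambda>z::real. 0) \<longlongrightarrow> (0::real)) at_top" by simp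
  have "filterlim (\<lambda>z::real. z / 2) at_top at_top" by real_asymp
  from tendsto_mult_left[OF filterlim_compose[OF I_tendsto_0 this], of 2]
  show "((\<lambda>z. 2 * I (z / 2)) \<longlongrightarrow> 0) at_top" by simp
  show "\<forall>\<^sub>F z in at_top. 0 \<le> z * T z"
    using eventually_ge_at_top[of 0] by eventually_elim simp
  show "\<forall>\<^sub>F z in at_top. z * T z \<le> 2 * I (z / 2)"
    using eventually_ge_at_top[of 0] by eventually_elim (rule mult_T_le_I)
qed

text \<open>Telescoping along \<open>z, l z, l\<^sup>2 z, \<dots>\<close> replaces the integral comparison in Karamata's theorem.\<close>

lemma nonpos_if_increasing_geometric:
  fixes D :: "real \<Rightarrow> real"
  assumes "l > 1" "z0 > 0" "z0 \<le> z"
    and mono: "\<And>z. z0 \<le> z \<Longrightarrow> D z \<le> D (l * z)"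
    and le: "\<And>z. z0 \<le> z \<Longrightarrow> D z \<le> U z" and U: "(U \<longlongrightarrow> 0) at_top"
  shows "D z \<le> 0"
proof -
  have ge: "z \<le> l ^ k * z" for k
    using one_le_power[of l k] mult_right_mono[of 1 "l ^ k" z] assms by simp
  have "D z \<le> D (l ^ k * z)" for k
  proof (induction k)
    case (Suc k)
    also have "D (l ^ k * z) \<le> D (l ^ Suc k * z)"
      using mono[of "l ^ k * z"] ge[of k] assms(3) by (simp add: mult.assoc)
    finally show ?case .
  qed simp
  then have *: "D z \<le> U (l ^ k * z)" for k
    using le[of "l ^ k * z"] ge[of k] assms(3) by (meson order_trans)
  have "filterlim (\<lambda>k. l ^ k * z) at_top sequentially"
    using assms by (real_asymp simp: less_le_trans)
  with U have "(\<lambda>k. U (l ^ k * z)) \<longlonglongrightarrow> 0" by (rule filterlim_compose)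
  then show ?thesis using * by (intro LIMSEQ_le_const[where X="\<lambda>k. U (l ^ k * z)"]) auto
qed

text \<open>The constant solves \<open>A * (1 - l * p) = l - 1\<close>. With it
  \<open>I z - A * (z * T z)\<close> does not decrease from \<open>z\<close> to
  \<open>l * z\<close>, and it is bounded above by \<open>I z\<close>, which tends to 0.\<close>

lemma eventually_I_le:
  assumes l: "l > 1" and p: "l powr (- r) < p" "l * p < 1"
  shows "\<forall>\<^sub>F z in at_top. I z \<le> (l - 1) / (1 - l * p) * (z * T z)"
proof -
  define A where "A = (l - 1) / (1 - l * p)"
  have "A > 0" using l p by (simp add: A_def)
  obtain z0 where z0: "z0 > 0" "\<And>z. z \<ge> z0 \<Longrightarrow> T (l * z) \<le> p * T z"
    using eventually_conj[OF eventually_T_le[OF _ p(1)] eventually_gt_at_top[of 0]] l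
    unfolding eventually_at_top_linorder by (metis less_le_trans linorder_not_less nle_le zero_less_one)
  have "I z - A * (z * T z) \<le> 0" if "z \<ge> z0" for z
  proof (rule nonpos_if_increasing_geometric[where U = I, OF l z0(1) that _ _ I_tendsto_0])
    fix z assume z: "z0 \<le> z"
    have "I z \<le> I (l * z) + (l - 1) * (z * T z)"
      using I_diff_le[of z "l * z"] l z z0(1) by (simp add: algebra_simps)
    moreover have "A * (l * z * T (l * z)) \<le> A * (l * z * (p * T z))"
      using z0(2)[OF z] \<open>A > 0\<close> l z z0(1) by (intro mult_left_mono) auto
    moreover have "A * (1 - l * p) = l - 1" using p by (simp add: A_def)
    then have "(l - 1) * (z * T z) = A * (z * T z) - A * (l * z * (p * T z))"
      by (metis (no_types, opaque_lifting) left_diff_distrib mult.assoc mult.left_commute mult_1 right_diff_distrib)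
    ultimately show "I z - A * (z * T z) \<le> I (l * z) - A * (l * z * T (l * z))" by linarith
  next
    fix z assume "z0 \<le> z"
    then show "I z - A * (z * T z) \<le> I z" using \<open>A > 0\<close> z0(1) by simp
  qed
  then show ?thesis unfolding A_def eventually_at_top_linorder by auto
qed

text \<open>Mirror image of \<open>eventually_I_le\<close> with the sign of the difference reversed.
  The extra factor \<open>p\<close> arises because the drop of \<open>I\<close> is bounded below by
  the smaller tail \<open>T (l * z)\<close>; the vanishing upper bound is
  \<open>A * (z * T z)\<close>.\<close>

lemma eventually_I_ge:
  assumes l: "l > 1" and p: "p > 0" "p < l powr (- r)" "l * p < 1"
  shows "\<forall>\<^sub>F z in at_top. (l - 1) * p / (1 - l * p) * (z * T z) \<le> I z"
proof -
  define A where "A = (l - 1) * p / (1 - l * p)"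
  have "A > 0" using l p by (simp add: A_def)
  obtain z0 where z0: "z0 > 0" "\<And>z. z \<ge> z0 \<Longrightarrow> p * T z \<le> T (l * z)"
    using eventually_conj[OF eventually_T_ge[OF _ p(2)] eventually_gt_at_top[of 0]] l
    unfolding eventually_at_top_linorder by (metis less_le_trans linorder_not_less nle_le zero_less_one)
  have "A * (z * T z) - I z \<le> 0" if "z \<ge> z0" for z
  proof (rule nonpos_if_increasing_geometric[where U = "\<lambda>z. A * (z * T z)", OF l z0(1) that])
    fix z assume z: "z0 \<le> z"
    have "I (l * z) + (l - 1) * (z * T (l * z)) \<le> I z"
      using I_diff_ge[of z "l * z"] l z z0(1) by (simp add: algebra_simps)
    moreover have "(l - 1) * (z * (p * T z)) \<le> (l - 1) * (z * T (l * z))"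
      using z0(2)[OF z] l z z0(1) by (intro mult_left_mono) auto
    moreover have "A * (l * z * (p * T z)) \<le> A * (l * z * T (l * z))"
      using z0(2)[OF z] \<open>A > 0\<close> l z z0(1) by (intro mult_left_mono) auto
    moreover have "A * (1 - l * p) = (l - 1) * p" using p by (simp add: A_def)
    then have "(l - 1) * (z * (p * T z)) = A * (z * T z) - A * (l * z * (p * T z))"
      by (metis (no_types, opaque_lifting) left_diff_distrib mult.assoc mult.left_commute mult_1 right_diff_distrib)
    ultimately show "A * (z * T z) - I z \<le> A * (l * z * T (l * z)) - I (l * z)" by linarith
  next
    show "((\<lambda>z. A * (z * T z)) \<longlongrightarrow> 0) at_top"
      using tendsto_mult_left[OF mult_T_tendsto_0, of A] by simp
  qed simp
  then show ?thesis unfolding A_def eventually_at_top_linorder by auto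
qed

lemma l_powr_less: "l > 1 \<Longrightarrow> l * l powr (- r) < 1"
  using r_gt_1 powr_less_cancel_iff[of l "1 - r" 0] by (simp add: powr_mult_base)

text \<open>At \<open>p = l powr (- r)\<close> the constants of both one-sided bounds tend to
  \<open>1 / (r - 1)\<close> as \<open>l\<close> decreases to 1. First \<open>l\<close> is fixed
  near 1, then \<open>p\<close> is moved slightly off that value, since the bounds ask for strict
  inequalities; continuity in \<open>p\<close> keeps the constant on the correct side of
  \<open>b\<close>.\<close>

theorem I_asymp: "((\<lambda>z. I z / (z * T z)) \<longlongrightarrow> 1 / (r - 1)) at_top"
proof (rule order_tendstoI)
  fix b assume b: "1 / (r - 1) < b"
  have "((\<lambda>l. (l - 1) / (1 - l * l powr (- r))) \<longlongrightarrow> 1 / (r - 1)) (at_right 1)"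
    using r_gt_1 by (real_asymp simp: inverse_eq_divide)
  from order_tendstoD(2)[OF this b] eventually_at_right_less[of 1]
  have "\<forall>\<^sub>F l in at_right 1. (l - 1) / (1 - l * l powr (- r)) < b \<and> 1 < l"
    by eventually_elim simp
  then obtain l where l: "l > 1" "(l - 1) / (1 - l * l powr (- r)) < b"
    using eventually_happens'[OF trivial_limit_at_right_real] by blast
  have "isCont (\<lambda>p. (l - 1) / (1 - l * p)) (l powr (- r))"
    using l_powr_less[OF l(1)] by (intro continuous_intros) auto
  then have "((\<lambda>p. (l - 1) / (1 - l * p)) \<longlongrightarrow> (l - 1) / (1 - l * l powr (- r))) (at_right (l powr (- r)))"
    by (simp add: isCont_def filterlim_at_split)
  from order_tendstoD(2)[OF this l(2)]
  have 1: "\<forall>\<^sub>F p in at_right (l powr (- r)). (l - 1) / (1 - l * p) < b" .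
  have "l powr (- r) < 1 / l" using l_powr_less[OF l(1)] l(1) by (simp add: field_simps)
  then have 2: "\<forall>\<^sub>F p in at_right (l powr (- r)). p < 1 / l \<and> l powr (- r) < p"
    unfolding eventually_at_right_field by (metis)
  obtain p where p: "l powr (- r) < p" "p < 1 / l" "(l - 1) / (1 - l * p) < b"
    using eventually_happens'[OF trivial_limit_at_right_real eventually_conj[OF 1 2]] by blast
  then have "l * p < 1" using l(1) by (simp add: field_simps)
  from eventually_I_le[OF l(1) p(1) this] eventually_gt_at_top[of 0]
  show "\<forall>\<^sub>F z in at_top. I z / (z * T z) < b"
  proof eventually_elim
    case (elim z)
    then have "0 < z * T z" using T_pos by simp
    then have "I z / (z * T z) \<le> (l - 1) / (1 - l * p)" using elim(1) by (simp add: pos_divide_le_eq)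
    then show ?case using p(3) by simp
  qed
next
  fix b assume b: "b < 1 / (r - 1)"
  have "((\<lambda>l. (l - 1) * l powr (- r) / (1 - l * l powr (- r))) \<longlongrightarrow> 1 / (r - 1)) (at_right 1)"
    using r_gt_1 by (real_asymp simp: inverse_eq_divide)
  from order_tendstoD(1)[OF this b] eventually_at_right_less[of 1]
  have "\<forall>\<^sub>F l in at_right 1. b < (l - 1) * l powr (- r) / (1 - l * l powr (- r)) \<and> 1 < l"
    by eventually_elim simp
  then obtain l where l: "l > 1" "b < (l - 1) * l powr (- r) / (1 - l * l powr (- r))"
    using eventually_happens'[OF trivial_limit_at_right_real] by blast
  have "isCont (\<lambda>p. (l - 1) * p / (1 - l * p)) (l powr (- r))"
    using l_powr_less[OF l(1)] by (intro continuous_intros) auto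
  then have "((\<lambda>p. (l - 1) * p / (1 - l * p)) \<longlongrightarrow> (l - 1) * l powr (- r) / (1 - l * l powr (- r))) (at_left (l powr (- r)))"
    by (simp add: isCont_def filterlim_at_split)
  from order_tendstoD(1)[OF this l(2)]
  have 1: "\<forall>\<^sub>F p in at_left (l powr (- r)). b < (l - 1) * p / (1 - l * p)" .
  have "0 < l powr (- r)" using l(1) by simp
  then have 2: "\<forall>\<^sub>F p in at_left (l powr (- r)). 0 < p \<and> p < l powr (- r)"
    unfolding eventually_at_left_field by (metis)
  obtain p where p: "p > 0" "p < l powr (- r)" "b < (l - 1) * p / (1 - l * p)"
    using eventually_happens'[OF trivial_limit_at_left_real eventually_conj[OF 1 2]] by blast
  have "l * p < l * l powr (- r)" using p(2) l(1) by simp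
  then have "l * p < 1" using l_powr_less[OF l(1)] by simp
  from eventually_I_ge[OF l(1) p(1,2) this] eventually_gt_at_top[of 0]
  show "\<forall>\<^sub>F z in at_top. b < I z / (z * T z)"
  proof eventually_elim
    case (elim z)
    then have "0 < z * T z" using T_pos by simp
    then have "(l - 1) * p / (1 - l * p) \<le> I z / (z * T z)" using elim(1) by (simp add: pos_le_divide_eq)
    then show ?case using p(3) by simp
  qed
qed

end

section \<open>The upper barrier\<close>

text \<open>\<open>huber b\<close> approximates the positive part, with slope in \<open>[0, 1]\<close> and second derivative at
  most \<open>1 / b\<close>. Since \<open>T\<close> is only monotone, \<open>I\<close> itself has no usable second-order expansion.\<close>

definition huber :: "real \<Rightarrow> real \<Rightarrow> real" where
  "huber b z = (if z \<le> 0 then 0 else if z \<le> b then z\<^sup>2 / (2 * b) else z - b / 2)"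

definition huber_slope :: "real \<Rightarrow> real \<Rightarrow> real" where
  "huber_slope b z = (if z \<le> 0 then 0 else if z \<le> b then z / b else 1)"

lemma huber_nonneg: "b > 0 \<Longrightarrow> 0 \<le> huber b z"
  by (auto simp: huber_def)

lemma huber_slope_bounds: "b > 0 \<Longrightarrow> 0 \<le> huber_slope b z" "b > 0 \<Longrightarrow> huber_slope b z \<le> 1"
  by (auto simp: huber_slope_def)

lemma huber_lipschitz:
  assumes "b > 0" "z \<le> w"
  shows "huber b z \<le> huber b w" "huber b w \<le> huber b z + (w - z)"
proof -
  have sq: "v\<^sup>2 / (2 * b) - u\<^sup>2 / (2 * b) = (v - u) * ((v + u) / (2 * b))" for u v
    using assms by (simp add: field_simps power2_eq_square)
  have mid: "0 \<le> v\<^sup>2 / (2 * b) - u\<^sup>2 / (2 * b) \<and> v\<^sup>2 / (2 * b) - u\<^sup>2 / (2 * b) \<le> v - u"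
    if "0 \<le> u" "u \<le> v" "v \<le> b" for u v
  proof -
    have "0 \<le> (v + u) / (2 * b)" "(v + u) / (2 * b) \<le> 1" using that assms by auto
    then show ?thesis unfolding sq using that mult_left_mono[of "(v + u) / (2 * b)" 1 "v - u"] by simp
  qed
  have b2: "b\<^sup>2 / (2 * b) = b / 2" using assms by (simp add: power2_eq_square)
  have "huber b z \<le> huber b w \<and> huber b w \<le> huber b z + (w - z)"
    using mid[of z w] mid[of 0 w] mid[of z b] mid[of 0 b] assms b2
    by (auto simp: huber_def)
  then show "huber b z \<le> huber b w" "huber b w \<le> huber b z + (w - z)" by auto
qed

lemma huber_le: "b > 0 \<Longrightarrow> huber b z \<le> max 0 z"
  using huber_lipschitz(2)[of b "min 0 z" z] by (auto simp: huber_def split: if_splits)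

text \<open>Taylor's bound for a function that is only piecewise twice differentiable, obtained by
  cases on the branch containing \<open>z\<close> after multiplication by
  \<open>2 * b\<close>.\<close>

lemma huber_quadratic:
  assumes "b > 0"
  shows "huber b (z + t) \<le> huber b z + t * huber_slope b z + t\<^sup>2 / (2 * b)"
proof -
  define w where "w = z + t"
  have *: "(2 * b) * huber b u = (if u \<le> 0 then 0 else if u \<le> b then u\<^sup>2 else 2 * b * u - b\<^sup>2)" for u
    using assms by (auto simp: huber_def field_simps power2_eq_square)
  have **: "(2 * b) * (t * huber_slope b z) = (if z \<le> 0 then 0 else if z \<le> b then 2 * t * z else 2 * b * t)"
    using assms by (auto simp: huber_slope_def field_simps)
  \<comment> \<open>The linear branch lies below the parabola, so \<open>w\<^sup>2\<close> bounds
    \<open>2 * b * huber b w\<close> on all branches; for \<open>z\<close> on the quadratic branch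
    it equals the right side.\<close>
  have sq1: "2 * b * w - b\<^sup>2 \<le> w\<^sup>2" using zero_le_power2[of "w - b"] by (simp add: power2_diff mult_ac)
  have w2: "w\<^sup>2 = z\<^sup>2 + 2 * t * z + t\<^sup>2" by (simp add: w_def power2_sum)
  have "(2 * b) * huber b w \<le> (2 * b) * huber b z + (2 * b) * (t * huber_slope b z) + t\<^sup>2"
  proof -
    consider "z \<le> 0" | "0 < z" "z \<le> b" | "b < z" by linarith
    then show ?thesis
    proof cases
      case 1
      have "w > 0 \<Longrightarrow> w\<^sup>2 \<le> t\<^sup>2" using 1 by (intro power_mono) (auto simp: w_def)
      then show ?thesis using 1 sq1 unfolding * ** by auto
    next
      case 2
      then show ?thesis using sq1 w2 zero_le_power2[of w] unfolding * ** by auto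
    next
      case 3
      have t2: "t\<^sup>2 = (z - w)\<^sup>2" by (simp add: w_def)
      have lin: "2 * b * z - b\<^sup>2 + 2 * b * t = 2 * b * w - b\<^sup>2" by (simp add: w_def algebra_simps)
      have "(2 * b) * huber b w \<le> 2 * b * w - b\<^sup>2 + t\<^sup>2"
      proof (cases "w \<le> b")
        case True
        then have "(b - w)\<^sup>2 \<le> (z - w)\<^sup>2" using 3 by (intro power_mono) auto
        then have "w\<^sup>2 \<le> 2 * b * w - b\<^sup>2 + t\<^sup>2" unfolding t2 by (simp add: power2_diff)
        moreover have "(2 * b) * huber b w \<le> w\<^sup>2" using True unfolding * by simp
        ultimately show ?thesis by linarith
      next
        case False
        then show ?thesis using assms unfolding * by simp
      qed
      then show ?thesis using 3 assms lin unfolding *[of z] ** by simp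
    qed
  qed
  also have "\<dots> = (2 * b) * (huber b z + t * huber_slope b z + t\<^sup>2 / (2 * b))"
    using assms by (simp add: algebra_simps)
  finally show ?thesis unfolding w_def using assms by (subst (asm) mult_le_cancel_left_pos) auto
qed

lemma measurable_huber [measurable]:
  assumes [measurable]: "f \<in> borel_measurable M" "g \<in> borel_measurable M"
  shows "(\<lambda>u. huber (f u) (g u)) \<in> borel_measurable M"
    and "(\<lambda>u. huber_slope (f u) (g u)) \<in> borel_measurable M"
  unfolding huber_def huber_slope_def by measurable

section \<open>Truncated second moment\<close>

context regularly_varying_law
begin

definition Q :: "real \<Rightarrow> real" where "Q y = expectation (\<lambda>u. (min (max 0 u) y)\<^sup>2)"

lemma integrable_truncated_square: "integrable F (\<lambda>u. (min (max 0 u) y)\<^sup>2)"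
proof (rule integrable_const_bound[where B = "y\<^sup>2"])
  show "AE u in F. norm ((min (max 0 u) y)\<^sup>2) \<le> y\<^sup>2"
    by (auto simp: abs_le_square_iff[symmetric])
qed simp

lemma Q_mono: "0 \<le> y \<Longrightarrow> y \<le> z \<Longrightarrow> Q y \<le> Q z"
  unfolding Q_def by (intro integral_mono integrable_truncated_square power_mono) auto

text \<open>Where \<open>u\<close> exceeds \<open>z\<close>, the capped square grows from
  \<open>z\<^sup>2\<close> to at most \<open>4 * z\<^sup>2\<close>, hence the factor 3.\<close>

lemma Q_double_le:
  assumes "0 \<le> z"
  shows "Q (2 * z) \<le> Q z + 3 * (z\<^sup>2 * T z)"
proof -
  have "Q (2 * z) \<le> expectation (\<lambda>u. (min (max 0 u) z)\<^sup>2 + 3 * z\<^sup>2 * indicator {z<..} u)"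
    unfolding Q_def
  proof (intro integral_mono Bochner_Integration.integrable_add integrable_mult_right
      integrable_truncated_square integrable_indicator_real)
    fix u :: real
    have "(min (max 0 u) (2 * z))\<^sup>2 \<le> (2 * z)\<^sup>2" using assms by (intro power_mono) auto
    then show "(min (max 0 u) (2 * z))\<^sup>2 \<le> (min (max 0 u) z)\<^sup>2 + 3 * z\<^sup>2 * indicator {z<..} u"
      using assms by (cases "z < u") (auto simp: min_def max_def power_mult_distrib)
  qed
  also have "\<dots> = Q z + 3 * (z\<^sup>2 * T z)"
    using integrable_truncated_square by (simp add: Q_def T_def)
  finally show ?thesis .
qed

text \<open>The function \<open>z\<^sup>2 * T z\<close> varies regularly with index
  \<open>2 - r\<close>; half of that index leaves strict room for a doubling bound and is still
  positive.\<close>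

lemma powr_bounds: "2 powr ((2 - r) / 2) / 4 < 2 powr (- r)" "1 < 2 powr ((2 - r) / 2)"
proof -
  have "2 powr ((2 - r) / 2) / 4 = 2 powr ((2 - r) / 2 - 2)" by (simp add: powr_diff)
  also have "\<dots> < 2 powr (- r)" using r_less_2 by (intro powr_less_mono) (auto simp: field_simps)
  finally show "2 powr ((2 - r) / 2) / 4 < 2 powr (- r)" .
  show "1 < 2 powr ((2 - r) / 2)" using r_less_2 powr_less_mono[of 0 "(2 - r) / 2" 2] by simp
qed

lemma square_T_doubling:
  obtains z0 where "z0 > 0" "\<And>z. z0 \<le> z \<Longrightarrow> 2 powr ((2 - r) / 2) * (z\<^sup>2 * T z) \<le> (2 * z)\<^sup>2 * T (2 * z)"
proof -
  obtain z0 where z0: "z0 > 0" "\<And>z. z0 \<le> z \<Longrightarrow> 2 powr ((2 - r) / 2) / 4 * T z \<le> T (2 * z)"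
    using eventually_conj[OF eventually_T_ge[OF _ powr_bounds(1)] eventually_gt_at_top[of 0]]
    unfolding eventually_at_top_linorder by (metis less_le_trans linorder_not_less nle_le zero_less_numeral)
  show ?thesis
  proof (rule that[OF z0(1)])
    fix z assume "z0 \<le> z"
    from mult_left_mono[OF z0(2)[OF this], of "4 * z\<^sup>2"]
    show "2 powr ((2 - r) / 2) * (z\<^sup>2 * T z) \<le> (2 * z)\<^sup>2 * T (2 * z)"
      by (simp add: power_mult_distrib mult_ac)
  qed
qed

lemma square_T_at_top: "filterlim (\<lambda>z. z\<^sup>2 * T z) at_top at_top"
proof -
  define \<gamma> where "\<gamma> = (2 - r) / 2"
  have "\<gamma> > 0" using r_less_2 by (simp add: \<gamma>_def)
  obtain z0 where z0: "z0 > 0" "\<And>z. z0 \<le> z \<Longrightarrow> 2 powr \<gamma> * (z\<^sup>2 * T z) \<le> (2 * z)\<^sup>2 * T (2 * z)"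
    using square_T_doubling unfolding \<gamma>_def by blast
  \<comment> \<open>Chosen so that the power bound holds on the first interval: \<open>T\<close> and
    the power are both evaluated at the worst endpoint \<open>2 * z0\<close>.\<close>
  define d where "d = z0\<^sup>2 * T (2 * z0) / (2 * z0) powr \<gamma>"
  have "d > 0" using z0(1) T_pos by (simp add: d_def)
  have *: "d * z powr \<gamma> \<le> z\<^sup>2 * T z" if "z0 \<le> z" for z
  proof (rule dyadic_induct[OF z0(1) that, of "\<lambda>z. d * z powr \<gamma> \<le> z\<^sup>2 * T z"])
    fix z assume z: "z0 \<le> z" "z \<le> 2 * z0"
    have "d * z powr \<gamma> \<le> d * (2 * z0) powr \<gamma>"
      using z z0(1) \<open>d > 0\<close> \<open>\<gamma> > 0\<close> by (intro mult_left_mono powr_mono2) auto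
    also have "\<dots> = z0\<^sup>2 * T (2 * z0)" using z0(1) by (simp add: d_def)
    also have "\<dots> \<le> z\<^sup>2 * T z" using z z0(1) by (intro mult_mono power_mono T_antimono) auto
    finally show "d * z powr \<gamma> \<le> z\<^sup>2 * T z" .
  next
    fix z assume z: "z0 \<le> z" and IH: "d * z powr \<gamma> \<le> z\<^sup>2 * T z"
    have "d * (2 * z) powr \<gamma> = 2 powr \<gamma> * (d * z powr \<gamma>)" using z z0(1) by (simp add: powr_mult)
    also have "\<dots> \<le> 2 powr \<gamma> * (z\<^sup>2 * T z)" using IH by (intro mult_left_mono) auto
    also have "\<dots> \<le> (2 * z)\<^sup>2 * T (2 * z)" by (rule z0(2)[OF z])
    finally show "d * (2 * z) powr \<gamma> \<le> (2 * z)\<^sup>2 * T (2 * z)" .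
  qed
  have "filterlim (\<lambda>z. d * z powr \<gamma>) at_top at_top"
    using \<open>d > 0\<close> \<open>\<gamma> > 0\<close> by real_asymp
  then show ?thesis
    by (rule filterlim_at_top_mono) (use * in \<open>auto simp: eventually_at_top_linorder\<close>)
qed

text \<open>Each doubling adds at most 3 times \<open>z\<^sup>2 * T z\<close> to \<open>Q\<close>,
  while \<open>z\<^sup>2 * T z\<close> grows by a factor \<open>g > 1\<close>, so the last term
  dominates as in a geometric series. The constant satisfies \<open>A * g = A + 3\<close>; the
  initial value is absorbed because \<open>z\<^sup>2 * T z\<close> tends to infinity.\<close>

lemma eventually_Q_le: "\<exists>B>0. \<forall>\<^sub>F z in at_top. Q z \<le> B * (z\<^sup>2 * T z)"
proof -
  define g where "g = 2 powr ((2 - r) / 2)"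
  have g: "g > 1" using powr_bounds by (simp add: g_def)
  obtain z0 where z0: "z0 > 0" "\<And>z. z0 \<le> z \<Longrightarrow> g * (z\<^sup>2 * T z) \<le> (2 * z)\<^sup>2 * T (2 * z)"
    using square_T_doubling unfolding g_def by blast
  define A where "A = 3 / (g - 1)"
  have "A > 0" "A * g = A + 3" using g by (auto simp: A_def field_simps)
  have *: "Q z \<le> Q (2 * z0) + A * (z\<^sup>2 * T z)" if "z0 \<le> z" for z
  proof (rule dyadic_induct[OF z0(1) that, of "\<lambda>z. Q z \<le> Q (2 * z0) + A * (z\<^sup>2 * T z)"])
    fix z assume z: "z0 \<le> z" "z \<le> 2 * z0"
    have "Q z \<le> Q (2 * z0)" using z z0(1) by (intro Q_mono) auto
    moreover have "0 \<le> A * (z\<^sup>2 * T z)" using \<open>A > 0\<close> by simp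
    ultimately show "Q z \<le> Q (2 * z0) + A * (z\<^sup>2 * T z)" by linarith
  next
    fix z assume z: "z0 \<le> z" and IH: "Q z \<le> Q (2 * z0) + A * (z\<^sup>2 * T z)"
    have "Q (2 * z) \<le> Q (2 * z0) + (A + 3) * (z\<^sup>2 * T z)"
      using Q_double_le[of z] IH z z0(1) by (simp add: algebra_simps)
    also have "(A + 3) * (z\<^sup>2 * T z) = A * (g * (z\<^sup>2 * T z))"
      using \<open>A * g = A + 3\<close> by (simp add: mult.assoc[symmetric])
    also have "\<dots> \<le> A * ((2 * z)\<^sup>2 * T (2 * z))"
      using z0(2)[OF z] \<open>A > 0\<close> by simp
    finally show "Q (2 * z) \<le> Q (2 * z0) + A * ((2 * z)\<^sup>2 * T (2 * z))" by simp
  qed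
  have "\<forall>\<^sub>F z in at_top. Q (2 * z0) \<le> z\<^sup>2 * T z"
    using square_T_at_top by (simp add: filterlim_at_top)
  then have "\<forall>\<^sub>F z in at_top. Q z \<le> (A + 1) * (z\<^sup>2 * T z)"
    using eventually_ge_at_top[of z0]
    by eventually_elim (use * in \<open>force simp: algebra_simps\<close>)
  then show ?thesis using \<open>A > 0\<close> by (intro exI[of _ "A + 1"]) simp
qed

text \<open>The positive part contributes \<open>Q\<close>. By the finite second moment of the
  negative part, the latter and the shift by \<open>a\<close> contribute at most a constant, which
  \<open>y\<^sup>2 * T y\<close> absorbs.\<close>

lemma eventually_second_moment_le:
  "\<exists>B>0. \<forall>\<^sub>F y in at_top. \<forall>a. 0 < a \<and> a \<le> 1 \<longrightarrow>
     integrable F (\<lambda>v. (v - a)\<^sup>2 * indicator {..y} v) \<and>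
     expectation (\<lambda>v. (v - a)\<^sup>2 * indicator {..y} v) \<le> B * (y\<^sup>2 * T y)"
proof -
  obtain B where B: "B > 0" "\<forall>\<^sub>F z in at_top. Q z \<le> B * (z\<^sup>2 * T z)" using eventually_Q_le by blast
  define c where "c = 2 * expectation (\<lambda>v. (min 0 v)\<^sup>2) + 2"
  have "\<forall>\<^sub>F z in at_top. c \<le> z\<^sup>2 * T z"
    using square_T_at_top by (simp add: filterlim_at_top)
  with B(2) eventually_ge_at_top[of 0]
  have "\<forall>\<^sub>F y in at_top. \<forall>a. 0 < a \<and> a \<le> 1 \<longrightarrow>
     integrable F (\<lambda>v. (v - a)\<^sup>2 * indicator {..y} v) \<and>
     expectation (\<lambda>v. (v - a)\<^sup>2 * indicator {..y} v) \<le> (2 * B + 1) * (y\<^sup>2 * T y)"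
  proof eventually_elim
    case (elim y)
    show ?case
    proof (intro allI impI)
      fix a :: real assume a: "0 < a \<and> a \<le> 1"
      let ?h = "\<lambda>v. 2 * (min (max 0 v) y)\<^sup>2 + (2 * (min 0 v)\<^sup>2 + 2)"
      have int: "integrable F ?h"
        using integrable_neg_part integrable_truncated_square by simp
      have bound: "(v - a)\<^sup>2 * indicator {..y} v \<le> ?h v" for v
      proof -
        have "(v - a)\<^sup>2 \<le> 2 * v\<^sup>2 + 2 * a\<^sup>2"
          using zero_le_power2[of "v + a"] by (simp add: power2_sum power2_diff)
        moreover have "a\<^sup>2 \<le> 1" using a by (simp add: power_le_one)
        moreover have "v \<le> y \<Longrightarrow> v\<^sup>2 \<le> (min (max 0 v) y)\<^sup>2 + (min 0 v)\<^sup>2"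
          using elim by (cases "v \<ge> 0") auto
        ultimately show ?thesis by (cases "v \<le> y") auto
      qed
      have int': "integrable F (\<lambda>v. (v - a)\<^sup>2 * indicator {..y} v)"
        by (rule Bochner_Integration.integrable_bound[OF int]) (use bound in \<open>auto simp: abs_mult\<close>)
      have "expectation (\<lambda>v. (v - a)\<^sup>2 * indicator {..y} v) \<le> expectation ?h"
        by (intro integral_mono int int' bound)
      also have "\<dots> = 2 * Q y + c"
        using integrable_neg_part integrable_truncated_square by (simp add: Q_def c_def prob_space[simplified])
      also have "\<dots> \<le> (2 * B + 1) * (y\<^sup>2 * T y)" using elim by (simp add: algebra_simps)
      finally show "integrable F (\<lambda>v. (v - a)\<^sup>2 * indicator {..y} v) \<and>
          expectation (\<lambda>v. (v - a)\<^sup>2 * indicator {..y} v) \<le> (2 * B + 1) * (y\<^sup>2 * T y)"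
        using int' by blast
    qed
  qed
  then show ?thesis using B(1) by (intro exI[of _ "2 * B + 1"]) simp
qed

end

section \<open>Smoothed integrated tail\<close>

locale smoothed_tail = regularly_varying_law +
  fixes \<delta> :: real
  assumes delta_pos: "0 < \<delta>" and delta_le: "\<delta> \<le> 1 / 2"
begin

text \<open>The smoothing width \<open>\<delta> * u\<close> is proportional to the jump
  \<open>u\<close>: the curvature is then of order \<open>1 / (\<delta> * y)\<close> times a tail,
  while the slope stays close to the tail. The case \<open>u \<le> 0\<close> is split off to keep
  the width positive.\<close>

definition K :: "real \<Rightarrow> real" where
  "K y = expectation (\<lambda>u. if u \<le> 0 then 0 else huber (\<delta> * u) (u - y))"

text \<open>Minus the derivative of \<open>K\<close>.\<close>

definition D :: "real \<Rightarrow> real" where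
  "D y = expectation (\<lambda>u. if u \<le> 0 then 0 else huber_slope (\<delta> * u) (u - y))"

lemma integrable_K: "integrable F (\<lambda>u. if u \<le> 0 then 0 else huber (\<delta> * u) (u - y))"
  by (rule Bochner_Integration.integrable_bound[OF integrable_pos_part[of y]])
    (use delta_pos in \<open>auto simp: huber_nonneg huber_le\<close>)

lemma integrable_D: "integrable F (\<lambda>u. if u \<le> 0 then 0 else huber_slope (\<delta> * u) (u - y))"
  by (rule integrable_const_bound[where B=1]) (use delta_pos in \<open>auto simp: huber_slope_bounds\<close>)

lemma K_nonneg: "0 \<le> K y"
  unfolding K_def by (rule integral_nonneg_AE) (use delta_pos in \<open>auto simp: huber_nonneg\<close>)

lemma D_nonneg: "0 \<le> D y"
  unfolding D_def by (rule integral_nonneg_AE) (use delta_pos in \<open>auto simp: huber_slope_bounds\<close>)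

lemma K_le_I: "K y \<le> I y"
  unfolding K_def I_def
  by (intro integral_mono integrable_K integrable_pos_part) (use delta_pos in \<open>auto simp: huber_le\<close>)

lemma K_antimono: "y \<le> z \<Longrightarrow> K z \<le> K y"
  unfolding K_def
  by (intro integral_mono integrable_K) (use delta_pos in \<open>auto intro: huber_lipschitz\<close>)

lemma measurable_K [measurable]: "K \<in> borel_measurable borel"
proof -
  have "mono (\<lambda>y. - K y)" by (auto simp: mono_def K_antimono)
  from borel_measurable_uminus[OF borel_measurable_mono[OF this]] show ?thesis by simp
qed

text \<open>For \<open>u > 2 * y\<close> and \<open>\<delta> \<le> 1 / 2\<close> the linear branch
  of \<open>huber\<close> applies, and its value is at least \<open>y / 2\<close>.\<close>

lemma K_ge:
  assumes "y > 0"
  shows "y / 2 * T (2 * y) \<le> K y"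
proof -
  have "y / 2 * T (2 * y) = expectation (\<lambda>u. y / 2 * indicator {2 * y<..} u)"
    by (simp add: T_def)
  also have "\<dots> \<le> K y"
    unfolding K_def
  proof (intro integral_mono integrable_K integrable_mult_right integrable_indicator_real)
    fix u :: real
    show "y / 2 * indicator {2 * y<..} u \<le> (if u \<le> 0 then 0 else huber (\<delta> * u) (u - y))"
    proof (cases "2 * y < u")
      case True
      have "\<delta> * u \<le> 1 / 2 * u" using delta_le True assms by (intro mult_right_mono) auto
      then have "y / 2 \<le> huber (\<delta> * u) (u - y)" using True by (auto simp: huber_def)
      then show ?thesis using True assms by simp
    next
      case False
      then show ?thesis using delta_pos by (auto simp: huber_nonneg)
    qed
  qed
  finally show ?thesis .
qed

lemma K_pos: "y > 0 \<Longrightarrow> 0 < K y"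
  using K_ge[of y] T_pos[of "2 * y"] by (smt (verit) half_gt_zero mult_pos_pos)

text \<open>Slope 1 is reached once \<open>u - y > \<delta> * u\<close>, that is, for
  \<open>u > y / (1 - \<delta>)\<close>.\<close>

lemma D_ge:
  assumes "y > 0"
  shows "T (y / (1 - \<delta>)) \<le> D y"
proof -
  have "T (y / (1 - \<delta>)) = expectation (indicator {y / (1 - \<delta>)<..})"
    by (simp add: T_def)
  also have "\<dots> \<le> D y"
    unfolding D_def
  proof (intro integral_mono integrable_D integrable_indicator_real)
    fix u :: real
    show "indicator {y / (1 - \<delta>)<..} u \<le> (if u \<le> 0 then 0 else huber_slope (\<delta> * u) (u - y))"
    proof (cases "y / (1 - \<delta>) < u")
      case True
      moreover have "0 < y / (1 - \<delta>)" using assms delta_le by simp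
      ultimately have "u > 0" by linarith
      moreover have "\<delta> * u < u - y" using True delta_le by (simp add: field_simps)
      moreover have "0 < \<delta> * u" using delta_pos \<open>u > 0\<close> by simp
      ultimately show ?thesis by (simp add: huber_slope_def)
    next
      case False
      then show ?thesis using delta_pos by (auto simp: huber_slope_bounds)
    qed
  qed
  finally show ?thesis .
qed

text \<open>Since \<open>t \<le> y / 2\<close>, only jumps \<open>u > y / 2\<close> contribute, and
  for them the width \<open>\<delta> * u\<close> exceeds \<open>\<delta> * y / 2\<close>.\<close>

lemma K_quadratic:
  assumes "y > 0" "t \<le> y / 2"
  shows "K (y - t) \<le> K y + t * D y + t\<^sup>2 * (T (y / 2) / (\<delta> * y))"
proof -
  let ?k = "\<lambda>y u. if u \<le> 0 then 0 else huber (\<delta> * u) (u - y)"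
  let ?d = "\<lambda>u. if u \<le> 0 then 0 else huber_slope (\<delta> * u) (u - y)"
  have "K (y - t) \<le> expectation (\<lambda>u. ?k y u + t * ?d u + t\<^sup>2 / (\<delta> * y) * indicator {y / 2<..} u)"
    unfolding K_def
  proof (intro integral_mono Bochner_Integration.integrable_add integrable_mult_right integrable_K integrable_D
      integrable_indicator_real)
    fix u :: real
    show "?k (y - t) u \<le> ?k y u + t * ?d u + t\<^sup>2 / (\<delta> * y) * indicator {y / 2<..} u"
    proof (cases "y / 2 < u")
      case True
      then have "u > 0" using assms by simp
      have "huber (\<delta> * u) (u - y + t) \<le> huber (\<delta> * u) (u - y) + t * huber_slope (\<delta> * u) (u - y) + t\<^sup>2 / (2 * (\<delta> * u))"
        using \<open>u > 0\<close> delta_pos by (intro huber_quadratic) simp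
      moreover have "t\<^sup>2 / (2 * (\<delta> * u)) \<le> t\<^sup>2 / (\<delta> * y)"
        using True assms delta_pos by (intro divide_left_mono) (auto simp: mult_ac)
      ultimately show ?thesis using True \<open>u > 0\<close> by (simp add: algebra_simps)
    next
      case False
      then show ?thesis using assms by (auto simp: huber_def huber_slope_def)
    qed
  qed
  also have "\<dots> = K y + t * D y + t\<^sup>2 / (\<delta> * y) * T (y / 2)"
    using integrable_K[of y] integrable_D[of y] by (simp add: K_def D_def T_def)
  finally show ?thesis by (simp add: algebra_simps)
qed

lemma K_lipschitz:
  assumes "y > 0" "t \<le> y / 2"
  shows "\<bar>K (y - t) - K y\<bar> \<le> \<bar>t\<bar> * T (y / 2)"
proof -
  let ?k = "\<lambda>y u. if u \<le> 0 then 0 else huber (\<delta> * u) (u - y)"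
  have lip: "\<bar>?k (y - t) u - ?k y u\<bar> \<le> \<bar>t\<bar> * indicator {y / 2<..} u" for u
  proof (cases "y / 2 < u")
    case True
    then have "0 < \<delta> * u" "u > 0" using assms delta_pos by simp_all
    then show ?thesis
      using True huber_lipschitz[of "\<delta> * u" "u - y" "u - (y - t)"]
        huber_lipschitz[of "\<delta> * u" "u - (y - t)" "u - y"] by (cases "t \<ge> 0") auto
  next
    case False
    then show ?thesis using assms by (auto simp: huber_def)
  qed
  have "\<bar>K (y - t) - K y\<bar> = norm (expectation (\<lambda>u. ?k (y - t) u - ?k y u))"
    unfolding K_def using integrable_K by (subst Bochner_Integration.integral_diff) auto
  also have "\<dots> \<le> expectation (\<lambda>u. norm (?k (y - t) u - ?k y u))"
    by (rule integral_norm_bound)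
  also have "\<dots> \<le> expectation (\<lambda>u. \<bar>t\<bar> * indicator {y / 2<..} u)"
    by (intro integral_mono integrable_norm Bochner_Integration.integrable_diff integrable_K
        integrable_mult_right integrable_indicator_real) (use lip in auto)
  also have "\<dots> = \<bar>t\<bar> * T (y / 2)" by (simp add: T_def)
  finally show ?thesis .
qed

end

section \<open>One-step drift of the barrier\<close>

locale barrier = smoothed_tail +
  fixes \<alpha> C a :: real
  assumes alpha_nonneg: "0 \<le> \<alpha>" and C_nonneg: "0 \<le> C" and a_pos: "0 < a"
begin

definition G :: "real \<Rightarrow> real" where "G y = \<alpha> * (K y / a) + C * (K y / a)\<^sup>2"

lemma G_nonneg: "0 \<le> G y"
  using K_nonneg[of y] alpha_nonneg C_nonneg a_pos by (simp add: G_def)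

lemma G_antimono: "y \<le> z \<Longrightarrow> G z \<le> G y"
  unfolding G_def using K_nonneg[of z] K_antimono[of y z] alpha_nonneg C_nonneg a_pos
  by (intro add_mono mult_left_mono power_mono divide_right_mono) auto

lemma measurable_G [measurable]: "G \<in> borel_measurable borel"
  unfolding G_def by measurable

text \<open>With \<open>J = K y / a\<close> and \<open>s\<close> the increment of
  \<open>K / a\<close>, the polynomial expands exactly, with derivative
  \<open>\<alpha> + 2 * C * J\<close>. The term linear in \<open>s\<close> uses
  \<open>K_quadratic\<close>, the term \<open>C * s\<^sup>2\<close> the Lipschitz bound.\<close>

lemma G_quadratic:
  assumes "y > 0" "t \<le> y / 2"
  shows "G (y - t) \<le> G y + t * ((\<alpha> + 2 * C * (K y / a)) * D y / a)
    + t\<^sup>2 * ((\<alpha> + 2 * C * (K y / a)) * (T (y / 2) / (\<delta> * y * a)) + C * (T (y / 2) / a)\<^sup>2)"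
proof -
  define J where "J = K y / a"
  define s where "s = K (y - t) / a - J"
  have J: "0 \<le> J" using K_nonneg[of y] a_pos by (simp add: J_def)
  have s: "s \<le> t * (D y / a) + t\<^sup>2 * (T (y / 2) / (\<delta> * y * a))"
    using divide_right_mono[OF K_quadratic[OF assms], of a] a_pos
    by (simp add: s_def J_def add_divide_distrib)
  have "\<bar>s\<bar> = \<bar>K (y - t) - K y\<bar> / a"
    using a_pos by (simp add: s_def J_def diff_divide_distrib[symmetric])
  also have "\<dots> \<le> \<bar>t\<bar> * T (y / 2) / a"
    using K_lipschitz[OF assms] a_pos by (intro divide_right_mono) auto
  finally have "\<bar>s\<bar>\<^sup>2 \<le> (\<bar>t\<bar> * T (y / 2) / a)\<^sup>2" by (rule power_mono) simp
  then have s2: "s\<^sup>2 \<le> t\<^sup>2 * (T (y / 2) / a)\<^sup>2" by (simp add: power_mult_distrib power_divide)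
  have "G (y - t) = G y + (\<alpha> + 2 * C * J) * s + C * s\<^sup>2"
  proof -
    have "K (y - t) / a = J + s" by (simp add: s_def)
    then show ?thesis by (simp add: G_def J_def[symmetric] power2_sum algebra_simps)
  qed
  also have "\<dots> \<le> G y + (\<alpha> + 2 * C * J) * (t * (D y / a) + t\<^sup>2 * (T (y / 2) / (\<delta> * y * a)))
      + C * (t\<^sup>2 * (T (y / 2) / a)\<^sup>2)"
    using J alpha_nonneg C_nonneg s s2 by (intro add_mono mult_left_mono order_refl) auto
  finally show ?thesis by (simp add: J_def[symmetric] algebra_simps add_divide_distrib)
qed

text \<open>Jumps are split at \<open>\<delta> * y\<close> and \<open>(1 - \<delta>) * y\<close>:
  small ones use the quadratic expansion, moderate ones the bound \<open>G (\<delta> * y)\<close>,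
  the largest the cap 1. The linear term is nonnegative for the larger jumps, so it is kept for all
  \<open>v\<close>; as the mean is zero, it integrates to exactly \<open>- m * a\<close>.\<close>

lemma barrier_step:
  assumes y: "y > 0" "a \<le> y / 2"
    and int: "integrable F (\<lambda>v. (v - a)\<^sup>2 * indicator {..y} v)"
  shows "expectation (\<lambda>v. min 1 (G (y - (v - a)))) \<le> G y - (\<alpha> + 2 * C * (K y / a)) * D y
    + ((\<alpha> + 2 * C * (K y / a)) * (T (y / 2) / (\<delta> * y * a)) + C * (T (y / 2) / a)\<^sup>2)
        * expectation (\<lambda>v. (v - a)\<^sup>2 * indicator {..y} v)
    + G (\<delta> * y) * T (\<delta> * y) + T ((1 - \<delta>) * y)"
proof -
  define m where "m = (\<alpha> + 2 * C * (K y / a)) * D y / a"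
  define n where "n = (\<alpha> + 2 * C * (K y / a)) * (T (y / 2) / (\<delta> * y * a)) + C * (T (y / 2) / a)\<^sup>2"
  have "0 \<le> \<alpha> + 2 * C * (K y / a)" using K_nonneg[of y] alpha_nonneg C_nonneg a_pos by simp
  then have m: "0 \<le> m" and n: "0 \<le> n"
    using D_nonneg[of y] C_nonneg a_pos y delta_pos by (simp_all add: m_def n_def)
  let ?h = "\<lambda>v. G y + m * (v - a) + n * ((v - a)\<^sup>2 * indicator {..y} v)
      + G (\<delta> * y) * indicator {\<delta> * y<..} v + indicator {(1 - \<delta>) * y<..} v"
  have "\<delta> * y \<le> 1 / 2 * y" using delta_le y by (intro mult_right_mono) auto
  then have dy: "\<delta> * y \<le> y / 2" by simp
  have pointwise: "min 1 (G (y - (v - a))) \<le> ?h v" for v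
  proof -
    consider "v - a \<le> \<delta> * y" | "\<delta> * y < v - a" "v - a \<le> (1 - \<delta>) * y" | "(1 - \<delta>) * y < v - a" by linarith
    then show ?thesis
    proof cases
      case 1
      then have "v - a \<le> y / 2" "v \<le> y" using dy y(2) by linarith+
      then have "min 1 (G (y - (v - a))) \<le> G y + m * (v - a) + n * ((v - a)\<^sup>2 * indicator {..y} v)"
        using G_quadratic[OF y(1), of "v - a"] by (simp add: m_def n_def mult_ac min.coboundedI2)
      then show ?thesis using G_nonneg[of "\<delta> * y"] by (simp add: add_increasing2)
    next
      case 2
      then have "\<delta> * y \<le> y - (v - a)" by (simp add: algebra_simps)
      then have "G (y - (v - a)) \<le> G (\<delta> * y)" by (rule G_antimono)
      then have "min 1 (G (y - (v - a))) \<le> G (\<delta> * y) * indicator {\<delta> * y<..} v" using 2 a_pos by simp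
      moreover have "0 < v - a" using 2 y delta_pos by (smt (verit) mult_pos_pos)
      ultimately show ?thesis using G_nonneg[of y] m n
        by (simp add: add_increasing add_increasing2)
    next
      case 3
      have "0 \<le> \<delta> * y" using delta_pos y by simp
      have "0 \<le> (1 - \<delta>) * y" using delta_le y by simp
      then have "0 < v - a" using 3 by linarith
      then have "0 \<le> m * (v - a)" "0 \<le> n * ((v - a)\<^sup>2 * indicator {..y} v)"
          "0 \<le> G (\<delta> * y) * indicator {\<delta> * y<..} v"
        using m n G_nonneg by simp_all
      then show ?thesis using G_nonneg[of y] 3 a_pos by simp
    qed
  qed
  have int1: "integrable F (\<lambda>v. v - a)" using integrable_id by simp
  have "expectation (\<lambda>v. min 1 (G (y - (v - a)))) \<le> expectation ?h"
    by (intro integral_mono pointwise Bochner_Integration.integrable_add integrable_mult_right int int1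
        integrable_indicator_real integrable_const integrable_const_bound[where B=1, of "\<lambda>v. min 1 (G (y - (v - a)))"])
      (auto simp: G_nonneg)
  also have "\<dots> = G y + m * (- a) + n * expectation (\<lambda>v. (v - a)\<^sup>2 * indicator {..y} v)
      + G (\<delta> * y) * T (\<delta> * y) + T ((1 - \<delta>) * y)"
  proof -
    have "expectation (\<lambda>v. v - a) = - a"
      using integrable_id mean_zero by (simp add: prob_space[simplified])
    then show ?thesis using int int1 by (simp add: T_def prob_space[simplified])
  qed
  also have "m * (- a) = - ((\<alpha> + 2 * C * (K y / a)) * D y)"
    using a_pos by (simp add: m_def)
  finally show ?thesis by (simp add: n_def)
qed

end

text \<open>\<open>T2\<close>, \<open>Td\<close>, \<open>T'\<close>, \<open>k\<close>, \<open>Kd\<close> and \<open>M\<close> stand for \<open>T(y/2)\<close>, \<open>T(\<delta> y)\<close>, \<open>T((1-\<delta>) y)\<close>,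
  \<open>K(y)\<close>, \<open>K(\<delta> y)\<close> and the truncated second moment in \<open>barrier_step\<close>.\<close>

lemma barrier_inequality:
  fixes e d B N C J T y a k :: real
  assumes e: "0 < e" "e \<le> 1" and d: "0 < d" and B: "0 \<le> B"
    and N: "N = 2 * (2 * (B ^ 3 / d) + (B ^ 5 + B ^ 3) + B\<^sup>2)" and C: "N\<^sup>2 \<le> C" "2 * N \<le> C"
    and pos: "0 < T" "0 < a" "0 < y" "0 \<le> k" and J: "J = k / a" "C * J\<^sup>2 \<le> 1"
    and T2: "0 \<le> T2" "T2 \<le> B * T" and Td: "0 \<le> Td" "Td \<le> B * T"
    and T': "T' \<le> (1 + e / 4) * T" and D: "(1 - e / 4) * T \<le> D"
    and yT: "y * T \<le> B * k" and M: "0 \<le> M" "M \<le> B * (y\<^sup>2 * T)" and Kd: "0 \<le> Kd" "Kd \<le> B * k"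
  shows "((1 + e + 2 * C * J) * (T2 / (d * y * a)) + C * (T2 / a)\<^sup>2) * M
    + ((1 + e) * (Kd / a) + C * (Kd / a)\<^sup>2) * Td + T' \<le> (1 + e + 2 * C * J) * D"
proof -
  \<comment> \<open>\<open>p\<close> collects the cost of the curvature of \<open>K\<close>,
    \<open>q\<close> the two costs proportional to \<open>C * J\<^sup>2\<close>, and
    \<open>s\<close> the linear cost of moderately large jumps.\<close>
  define p where "p = B ^ 3 / d"
  define q where "q = B ^ 5 + B ^ 3"
  define s where "s = B\<^sup>2"
  have nn: "0 \<le> p" "0 \<le> q" "0 \<le> s" using B d by (simp_all add: p_def q_def s_def)
  have N': "N = 2 * (2 * p + q + s)" by (simp add: N p_def q_def s_def)
  have C0: "0 \<le> C" using C(1) zero_le_power2[of N] by linarith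
  have J0: "0 \<le> J" using J pos by simp
  have yTa: "y * T / a \<le> B * J" "0 \<le> y * T / a"
    using divide_right_mono[OF yT, of a] pos by (simp_all add: J)
  have h1: "T2 / (d * y * a) * M \<le> p * T * J"
  proof -
    have "T2 / (d * y * a) * M \<le> (B * T) / (d * y * a) * (B * (y\<^sup>2 * T))"
      using T2 M pos d B by (intro mult_mono divide_right_mono) auto
    also have "\<dots> = B\<^sup>2 / d * T * (y * T / a)" using pos d by (simp add: field_simps power2_eq_square)
    also have "\<dots> \<le> B\<^sup>2 / d * T * (B * J)"
      using yTa pos d by (intro mult_left_mono) auto
    finally show ?thesis by (simp add: p_def power2_eq_square power3_eq_cube mult_ac)
  qed
  have h2: "(T2 / a)\<^sup>2 * M \<le> B ^ 5 * T * J\<^sup>2"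
  proof -
    have "(T2 / a)\<^sup>2 * M \<le> (B * T / a)\<^sup>2 * (B * (y\<^sup>2 * T))"
      using T2 M pos B by (intro mult_mono divide_right_mono power_mono) auto
    also have "\<dots> = B ^ 3 * T * (y * T / a)\<^sup>2" using pos by (simp add: field_simps power2_eq_square power3_eq_cube)
    also have "\<dots> \<le> B ^ 3 * T * (B * J)\<^sup>2"
      using yTa pos B by (intro mult_left_mono power_mono) auto
    finally show ?thesis by (simp add: power_mult_distrib mult_ac flip: power_add)
  qed
  have Kda: "Kd / a \<le> B * J" "0 \<le> Kd / a"
    using divide_right_mono[OF Kd(2), of a] Kd(1) pos by (simp_all add: J)
  have h3: "Kd / a * Td \<le> s * T * J"
  proof -
    have "Kd / a * Td \<le> (B * J) * (B * T)" using Kda Td B J0 by (intro mult_mono) auto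
    then show ?thesis by (simp add: s_def power2_eq_square mult_ac)
  qed
  have h4: "(Kd / a)\<^sup>2 * Td \<le> B ^ 3 * T * J\<^sup>2"
  proof -
    have "(Kd / a)\<^sup>2 * Td \<le> (B * J)\<^sup>2 * (B * T)" using Kda Td B J0 by (intro mult_mono power_mono) auto
    then show ?thesis by (simp add: power2_eq_square power3_eq_cube mult_ac)
  qed
  \<comment> \<open>This is the claim divided by \<open>T\<close>. Of the gain
    \<open>2 * C * J\<close>, a quarter pays for the terms linear in \<open>J\<close> (by
    \<open>2 * N \<le> C\<close>), a quarter for those with \<open>C * J\<^sup>2\<close> (by
    \<open>N * J \<le> 1\<close>, from \<open>N\<^sup>2 \<le> C\<close> and
    \<open>C * J\<^sup>2 \<le> 1\<close>), and a quarter for the factor \<open>1 - e / 4\<close>. In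
    the constants, \<open>e / 2\<close> stands against \<open>e / 4\<close>.\<close>
  have scalar: "(1 + e + 2 * C * J) * (p * J) + C * q * J\<^sup>2 + (1 + e) * (s * J) + (1 + e / 4)
      \<le> (1 + e + 2 * C * J) * (1 - e / 4)"
  proof -
    have N0: "0 \<le> N" using nn N' by simp
    have "(N * J)\<^sup>2 \<le> C * J\<^sup>2" using C(1) by (simp add: power_mult_distrib mult_right_mono)
    then have "(N * J)\<^sup>2 \<le> 1" using J(2) by linarith
    then have NJ: "N * J \<le> 1" using N0 J0 by (simp add: power2_le_iff_abs_le[of 1 "N*J", simplified] abs_square_le_1)
    have CJ: "0 \<le> C * J" using C0 J0 by simp
    have a1: "(1 + e) * ((p + s) * J) \<le> 2 * ((p + s) * J)"
      using e nn J0 by (intro mult_right_mono) auto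
    have a2: "4 * ((p + s) * J) \<le> (2 * N) * J"
      unfolding mult.assoc[symmetric] using nn J0 by (intro mult_right_mono) (auto simp: N')
    have a3: "(2 * N) * J \<le> C * J" using C(2) J0 by (rule mult_right_mono)
    have a4: "(2 * p + q) * J \<le> N / 2 * J"
      using nn J0 by (intro mult_right_mono) (auto simp: N')
    have "(2 * p + q) * J \<le> 1 / 2" using a4 NJ by simp
    then have a5: "(C * J) * ((2 * p + q) * J) \<le> (C * J) * (1 / 2)" using CJ by (rule mult_left_mono)
    have a6: "e * (C * J) \<le> 1 * (C * J)" using e CJ by (intro mult_right_mono) auto
    define ee where "ee = e * e"
    have a7: "ee \<le> e" using mult_left_mono[of e 1 e] e by (simp add: ee_def)
    show ?thesis using a1 a2 a3 a5 a6 a7 CJ e by (simp add: algebra_simps power2_eq_square flip: ee_def)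
  qed
  have b0: "0 \<le> 1 + e + 2 * C * J" using e C0 J0 by simp
  have "((1 + e + 2 * C * J) * (T2 / (d * y * a)) + C * (T2 / a)\<^sup>2) * M
    + ((1 + e) * (Kd / a) + C * (Kd / a)\<^sup>2) * Td + T'
    = (1 + e + 2 * C * J) * (T2 / (d * y * a) * M) + C * ((T2 / a)\<^sup>2 * M)
    + (1 + e) * (Kd / a * Td) + C * ((Kd / a)\<^sup>2 * Td) + T'" by (simp add: algebra_simps add_divide_distrib)
  also have "\<dots> \<le> (1 + e + 2 * C * J) * (p * T * J) + C * (B ^ 5 * T * J\<^sup>2)
    + (1 + e) * (s * T * J) + C * (B ^ 3 * T * J\<^sup>2) + (1 + e / 4) * T"
    by (intro add_mono mult_left_mono h1 h2 h3 h4 T' b0 C0) (use e in auto)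
  also have "\<dots> = T * ((1 + e + 2 * C * J) * (p * J) + C * q * J\<^sup>2 + (1 + e) * (s * J) + (1 + e / 4))"
    by (simp add: q_def algebra_simps)
  also have "\<dots> \<le> T * ((1 + e + 2 * C * J) * (1 - e / 4))"
    using scalar pos by (intro mult_left_mono) auto
  also have "\<dots> \<le> (1 + e + 2 * C * J) * D"
    using mult_left_mono[OF D b0] by (simp add: mult_ac)
  finally show ?thesis .
qed

section \<open>Ratio limits and the smoothing parameter\<close>

context regularly_varying_law
begin

lemma I_ratio:
  assumes "s > 0"
  shows "((\<lambda>z. I (s * z) / (z * T z)) \<longlongrightarrow> s powr (1 - r) / (r - 1)) at_top"
proof -
  have "filterlim (\<lambda>z. s * z) at_top at_top" using assms by real_asymp
  from filterlim_compose[OF I_asymp this]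
  have "((\<lambda>z. I (s * z) / (s * z * T (s * z)) * (s * (T (s * z) / T z))) \<longlongrightarrow>
      1 / (r - 1) * (s * s powr (- r))) at_top"
    unfolding T_def[of "s * _"] T_def[of "_"] using tail_ratio'[OF assms]
    by (intro tendsto_mult tendsto_const) (simp_all add: T_def)
  moreover have "\<forall>\<^sub>F z in at_top. I (s * z) / (s * z * T (s * z)) * (s * (T (s * z) / T z)) = I (s * z) / (z * T z)"
    using eventually_gt_at_top[of 0]
  proof eventually_elim
    case (elim z)
    then show ?case using assms T_pos[of "s * z"] by (simp add: field_simps)
  qed
  moreover have "s * s powr (- r) = s powr (1 - r)" using assms by (simp add: powr_mult_base)
  ultimately show ?thesis by (auto dest: Lim_transform_eventually)
qed

lemma integral_shifted:
  fixes f :: "real \<Rightarrow> real"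
  assumes [measurable]: "f \<in> borel_measurable borel"
  shows "(\<integral>t. f t \<partial>distr F borel (\<lambda>u. u - a)) = expectation (\<lambda>v. f (v - a))"
  by (rule integral_distr) auto

text \<open>Both powers tend to 1 as \<open>d\<close> decreases to 0. They are the limits of
  \<open>T ((1 - d) * y) / T y\<close> and \<open>T (y / (1 - d)) / T y\<close>, which control the
  largest jumps and the slope \<open>D\<close>.\<close>

lemma exists_smoothing:
  assumes "0 < e"
  obtains d where "0 < d" "d \<le> 1 / 2" "(1 - d) powr (- r) < 1 + e" "1 - e < (1 / (1 - d)) powr (- r)"
proof -
  have "((\<lambda>d. (1 - d) powr (- r)) \<longlongrightarrow> 1) (at_right 0)" by real_asymp
  from order_tendstoD(2)[OF this, of "1 + e"] assms
  have 1: "\<forall>\<^sub>F d in at_right 0. (1 - d) powr (- r) < 1 + e" by simp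
  have "((\<lambda>d. (1 / (1 - d)) powr (- r)) \<longlongrightarrow> 1) (at_right 0)" by real_asymp
  from order_tendstoD(1)[OF this, of "1 - e"] assms
  have 2: "\<forall>\<^sub>F d in at_right 0. 1 - e < (1 / (1 - d)) powr (- r)" by simp
  have 3: "\<forall>\<^sub>F d in at_right (0::real). 0 < d \<and> d < 1 / 2"
    unfolding eventually_at_right_field by (rule exI[of _ "1 / 2"]) auto
  show ?thesis
    using eventually_happens'[OF trivial_limit_at_right_real eventually_conj[OF 1 eventually_conj[OF 2 3]]] that
    by (metis less_imp_le)
qed

section \<open>Bounds on the crossing probability\<close>

text \<open>Beyond a fixed distance \<open>Y\<close> the error terms of \<open>barrier_step\<close>
  stay below its drift gain, by \<open>barrier_inequality\<close>; taking \<open>a\<close> small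
  pushes the zone where the barrier is below 1 past \<open>Y\<close>.\<close>

theorem prob_walk_max_le:
  assumes e: "0 < e" "e \<le> 1"
  shows "\<exists>C\<ge>0. \<exists>a0>0. \<forall>a x (P :: 'w measure) \<xi>. 0 < a \<and> a < a0 \<and>
    walk_with_step_law P \<xi> (distr F borel (\<lambda>u. u - a)) \<longrightarrow>
    measure P {\<omega> \<in> space P. walk_max \<xi> \<omega> > ereal x} \<le> (1 + e) * (I x / a) + C * (I x / a)\<^sup>2"
proof -
  obtain d where d: "0 < d" "d \<le> 1 / 2" "(1 - d) powr (- r) < 1 + e / 4" "1 - e / 4 < (1 / (1 - d)) powr (- r)"
    using exists_smoothing[of "e / 4"] e by auto
  interpret S: smoothed_tail F r d by unfold_locales (use d in auto)
  define B1 where "B1 = (1 / 2) powr (- r) + 1"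
  define B2 where "B2 = d powr (- r) + 1"
  define B3 where "B3 = 4 / 2 powr (- r)"
  define A where "A = 1 / (r - 1) + 1"
  obtain B4 where B4: "B4 > 0" and second_moment: "\<forall>\<^sub>F y in at_top. \<forall>a. 0 < a \<and> a \<le> 1 \<longrightarrow>
     integrable F (\<lambda>v. (v - a)\<^sup>2 * indicator {..y} v) \<and>
     expectation (\<lambda>v. (v - a)\<^sup>2 * indicator {..y} v) \<le> B4 * (y\<^sup>2 * T y)"
    using eventually_second_moment_le by blast
  have Bpos: "B1 > 0" "B2 > 0" "B3 > 0" "A > 0"
    using d r_gt_1 by (simp_all add: B1_def B2_def B3_def A_def add_pos_pos add_nonneg_pos)
  \<comment> \<open>One constant for all comparisons; the last summand serves to compare
    \<open>K (d * y)\<close> with \<open>K y\<close> through \<open>I\<close> and the tail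
    ratios.\<close>
  define B where "B = B1 + B2 + B3 + B4 + A * B2 * B3"
  have B_ge: "B1 \<le> B" "B2 \<le> B" "B3 \<le> B" "B4 \<le> B" "A * B2 * B3 \<le> B" and B0: "0 \<le> B"
    using Bpos B4 by (simp_all add: B_def)
  have ev1: "\<forall>\<^sub>F y in at_top. T (1 / 2 * y) \<le> B1 * T y"
    by (rule eventually_T_le) (auto simp: B1_def)
  have ev2: "\<forall>\<^sub>F y in at_top. T (d * y) \<le> B2 * T y"
    by (rule eventually_T_le) (use d in \<open>auto simp: B2_def\<close>)
  have ev3: "\<forall>\<^sub>F y in at_top. 2 powr (- r) / 2 * T y \<le> T (2 * y)"
    by (rule eventually_T_ge) auto
  have ev4: "\<forall>\<^sub>F y in at_top. T ((1 - d) * y) \<le> (1 + e / 4) * T y"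
    by (rule eventually_T_le) (use d in auto)
  have ev5: "\<forall>\<^sub>F y in at_top. (1 - e / 4) * T y \<le> T (1 / (1 - d) * y)"
    by (rule eventually_T_ge) (use d in auto)
  have "\<forall>\<^sub>F y in at_top. I y / (y * T y) < A"
    by (rule order_tendstoD(2)[OF I_asymp]) (simp add: A_def)
  moreover have "filterlim (\<lambda>y. d * y) at_top at_top" using d by real_asymp
  ultimately have ev6: "\<forall>\<^sub>F y in at_top. I (d * y) / (d * y * T (d * y)) < A"
    by (rule eventually_compose_filterlim)
  define reg where "reg y \<longleftrightarrow>
      T (1 / 2 * y) \<le> B1 * T y \<and> T (d * y) \<le> B2 * T y \<and> 2 powr (- r) / 2 * T y \<le> T (2 * y) \<and>
      T ((1 - d) * y) \<le> (1 + e / 4) * T y \<and> (1 - e / 4) * T y \<le> T (1 / (1 - d) * y) \<and>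
      I (d * y) / (d * y * T (d * y)) < A \<and> (\<forall>a. 0 < a \<and> a \<le> 1 \<longrightarrow>
     integrable F (\<lambda>v. (v - a)\<^sup>2 * indicator {..y} v) \<and>
     expectation (\<lambda>v. (v - a)\<^sup>2 * indicator {..y} v) \<le> B4 * (y\<^sup>2 * T y))" for y
  have "\<forall>\<^sub>F y in at_top. reg y"
    unfolding reg_def by (intro eventually_conj ev1 ev2 ev3 ev4 ev5 ev6 second_moment)
  then obtain Y' where Y': "\<And>y. y \<ge> Y' \<Longrightarrow> reg y"
    by (auto simp: eventually_at_top_linorder)
  \<comment> \<open>\<open>Y \<ge> 2\<close> gives \<open>a \<le> 1 \<le> y / 2\<close>, as
    \<open>barrier_step\<close> requires.\<close>
  define Y where "Y = max 2 Y'"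
  have Y: "Y \<ge> 2" and regular: "\<And>y. y \<ge> Y \<Longrightarrow> reg y"
    using Y' by (auto simp: Y_def)
  define N where "N = 2 * (2 * (B ^ 3 / d) + (B ^ 5 + B ^ 3) + B\<^sup>2)"
  have "0 \<le> N" using B0 d by (simp add: N_def)
  define C where "C = N\<^sup>2 + 2 * N + 1"
  have C: "N\<^sup>2 \<le> C" "2 * N \<le> C" "1 \<le> C" using \<open>0 \<le> N\<close> by (simp_all add: C_def)
  \<comment> \<open>For \<open>a\<close> below \<open>K Y\<close> the ratio \<open>K Y / a\<close>
    exceeds 1, so with \<open>C \<ge> 1\<close> the barrier has already reached 1 at distance
    \<open>Y\<close>.\<close>
  define a0 where "a0 = min 1 (S.K Y)"
  have "a0 > 0" using S.K_pos[of Y] Y by (simp add: a0_def)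
  moreover have "measure P {\<omega> \<in> space P. walk_max \<xi> \<omega> > ereal x} \<le> (1 + e) * (I x / a) + C * (I x / a)\<^sup>2"
    if a: "0 < a" "a < a0" and "walk_with_step_law P \<xi> (distr F borel (\<lambda>u. u - a))"
    for a x and P :: "'w measure" and \<xi>
  proof -
    interpret P: walk_with_step_law P \<xi> "distr F borel (\<lambda>u. u - a)" by fact
    interpret G: barrier F r d "1 + e" C a by unfold_locales (use e C a in auto)
    define W where "W s = min 1 (G.G (x - s))" for s
    have G_Y: "1 \<le> G.G Y"
    proof -
      have "1 \<le> S.K Y / a" using a by (simp add: a0_def)
      then have "1 * 1\<^sup>2 \<le> C * (S.K Y / a)\<^sup>2" using C by (intro mult_mono power_mono) auto
      moreover have "0 \<le> (1 + e) * (S.K Y / a)" using S.K_nonneg[of Y] e a by simp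
      ultimately show ?thesis unfolding G.G_def by simp
    qed
    have "measure P {\<omega> \<in> space P. walk_max \<xi> \<omega> > ereal x} \<le> W 0"
    proof (rule P.prob_walk_max_le_superharmonic)
      show [measurable]: "W \<in> borel_measurable borel" unfolding W_def by measurable
      show "0 \<le> W s" "W s \<le> 1" for s by (auto simp: W_def G.G_nonneg)
      show "W s = 1" if "x < s" for s
        using G.G_antimono[of "x - s" Y] that Y G_Y by (simp add: W_def)
      fix s assume "s \<le> x"
      define y where "y = x - s"
      have "(\<integral>t. W (s + t) \<partial>distr F borel (\<lambda>u. u - a)) = expectation (\<lambda>v. W (s + (v - a)))"
        by (rule integral_shifted) measurable
      also have "\<dots> = expectation (\<lambda>v. min 1 (G.G (y - (v - a))))"
        by (simp add: W_def y_def algebra_simps)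
      also have "\<dots> \<le> min 1 (G.G y)"
      \<comment> \<open>Where the barrier is 1, the cap suffices. Otherwise \<open>y > Y\<close>, so
        all tail estimates hold, and \<open>G y < 1\<close> also yields
        \<open>C * J\<^sup>2 \<le> 1\<close>.\<close>
      proof (cases "G.G y < 1")
        case False
        have "expectation (\<lambda>v. min 1 (G.G (y - (v - a)))) \<le> 1"
          by (intro integral_le_const integrable_const_bound[where B=1]) (auto simp: G.G_nonneg)
        then show ?thesis using False by simp
      next
        case True
        then have "Y < y" using G.G_antimono[of y Y] G_Y by linarith
        then have y: "Y \<le> y" "0 < y" "a \<le> y / 2" "a \<le> 1" using Y a by (auto simp: a0_def)
        note reg = regular[OF y(1), unfolded reg_def]
        have int: "integrable F (\<lambda>v. (v - a)\<^sup>2 * indicator {..y} v)"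
          and M: "expectation (\<lambda>v. (v - a)\<^sup>2 * indicator {..y} v) \<le> B4 * (y\<^sup>2 * T y)"
          using reg a(1) y(4) by blast+
        have yT3: "y * T y \<le> B3 * S.K y"
        proof -
          have "y * (2 powr (- r) / 2 * T y) \<le> y * T (2 * y)" using reg y by (intro mult_left_mono) auto
          also have "\<dots> \<le> 2 * S.K y" using S.K_ge[OF y(2)] by simp
          finally show ?thesis by (simp add: B3_def field_simps)
        qed
        have Kd: "S.K (d * y) \<le> A * B2 * B3 * S.K y"
        proof -
          have "S.K (d * y) \<le> I (d * y)" by (rule S.K_le_I)
          also have "I (d * y) \<le> A * (d * y * T (d * y))"
            using reg d y T_pos[of "d * y"] by (simp add: pos_divide_less_eq)
          also have "d * y * T (d * y) \<le> 1 * y * (B2 * T y)"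
            using reg d y by (intro mult_mono) auto
          also have "A * (1 * y * (B2 * T y)) = A * B2 * (y * T y)" by simp
          also have "\<dots> \<le> A * B2 * (B3 * S.K y)"
            using yT3 Bpos by (intro mult_left_mono) auto
          finally show ?thesis using Bpos by (simp add: mult_left_mono mult_ac)
        qed
        define J where "J = S.K y / a"
        have J: "C * J\<^sup>2 \<le> 1"
        proof -
          have "0 \<le> (1 + e) * J" using S.K_nonneg[of y] e a by (simp add: J_def)
          then show ?thesis using True by (simp add: G.G_def J_def)
        qed
        have "((1 + e + 2 * C * J) * (T (y / 2) / (d * y * a)) + C * (T (y / 2) / a)\<^sup>2)
              * expectation (\<lambda>v. (v - a)\<^sup>2 * indicator {..y} v)
            + ((1 + e) * (S.K (d * y) / a) + C * (S.K (d * y) / a)\<^sup>2) * T (d * y) + T ((1 - d) * y)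
            \<le> (1 + e + 2 * C * J) * S.D y"
        proof (rule barrier_inequality[OF e d(1) B0 N_def C(1,2) T_pos a(1) y(2) S.K_nonneg J_def J])
          have up: "b * t \<le> B * t" if "b \<le> B" "0 \<le> t" for b t :: real
            using that by (rule mult_right_mono)
          show "T (y / 2) \<le> B * T y" using reg up[OF B_ge(1), of "T y"] by simp
          show "T (d * y) \<le> B * T y" using reg up[OF B_ge(2), of "T y"] by simp
          show "T ((1 - d) * y) \<le> (1 + e / 4) * T y" using reg by simp
          show "(1 - e / 4) * T y \<le> S.D y" using reg S.D_ge[OF y(2)] by simp
          show "y * T y \<le> B * S.K y" using yT3 up[OF B_ge(3) S.K_nonneg[of y]] by simp
          show "expectation (\<lambda>v. (v - a)\<^sup>2 * indicator {..y} v) \<le> B * (y\<^sup>2 * T y)"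
            using M up[OF B_ge(4), of "y\<^sup>2 * T y"] by simp
          show "0 \<le> expectation (\<lambda>v. (v - a)\<^sup>2 * indicator {..y} v)"
            by (rule integral_nonneg_AE) auto
          show "S.K (d * y) \<le> B * S.K y" using Kd up[OF B_ge(5) S.K_nonneg[of y]] by simp
        qed (auto simp: S.K_nonneg)
        with G.barrier_step[OF y(2,3) int] have "expectation (\<lambda>v. min 1 (G.G (y - (v - a)))) \<le> G.G y"
          unfolding G.G_def[of "d * y"] J_def by linarith
        then show ?thesis using True by simp
      qed
      finally show "(\<integral>t. W (s + t) \<partial>distr F borel (\<lambda>u. u - a)) \<le> W s" by (simp add: W_def y_def)
    qed
    also have "W 0 \<le> (1 + e) * (S.K x / a) + C * (S.K x / a)\<^sup>2" by (simp add: W_def G.G_def)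
    also have "\<dots> \<le> (1 + e) * (I x / a) + C * (I x / a)\<^sup>2"
      using S.K_le_I[of x] S.K_nonneg[of x] e C a
      by (intro add_mono mult_left_mono power_mono divide_right_mono) auto
    finally show ?thesis .
  qed
  ultimately show ?thesis using C(3) by (intro exI[of _ C] conjI exI[of _ a0]) auto
qed

text \<open>Distances are measured to \<open>x + R\<close>, so a walk at or below \<open>x\<close>
  is at distance at least \<open>R\<close>. There the hypothesis on \<open>I (R / 2)\<close> makes
  both \<open>I y / a\<close> and \<open>y * T y / a\<close> small, which controls the errors of a
  tangent minorant.\<close>

theorem prob_walk_max_ge:
  fixes P :: "'w measure"
  assumes e: "0 < e" "e \<le> 1" and a: "0 < a" "a \<le> 1" and R: "1 \<le> R" "I (R / 2) \<le> e / 8 * a"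
    and walk: "walk_with_step_law P \<xi> (distr F borel (\<lambda>u. u - a))" and x: "0 \<le> x"
  shows "(1 - e) * (I (x + R) / a) \<le> measure P {\<omega> \<in> space P. walk_max \<xi> \<omega> > ereal x}"
proof -
  interpret P: walk_with_step_law P \<xi> "distr F borel (\<lambda>u. u - a)" by fact
  define U where "U y = (if y < R then 1 else (1 - e) * (I y / a))" for y
  have [measurable]: "U \<in> borel_measurable borel" unfolding U_def by measurable
  have Ia: "I y / a \<le> e / 8" "y * T y / a \<le> e / 4" if "R \<le> y" for y
  proof -
    have "I (y / 2) \<le> I (R / 2)" using that by (intro I_antimono) auto
    then have "I (y / 2) / a \<le> e / 8" using R(2) a by (simp add: pos_divide_le_eq)
    moreover have "I y / a \<le> I (y / 2) / a" using that R a by (intro divide_right_mono I_antimono) auto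
    moreover have "y * T y / a \<le> 2 * (I (y / 2) / a)"
      using divide_right_mono[OF mult_T_le_I[of y], of a] that R a by simp
    ultimately show "I y / a \<le> e / 8" "y * T y / a \<le> e / 4" by linarith+
  qed
  have U01: "0 \<le> U y" "U y \<le> 1" for y
  proof -
    show "0 \<le> U y" using e a by (simp add: U_def)
    show "U y \<le> 1"
    proof (cases "y < R")
      case False
      then have "(1 - e) * (I y / a) \<le> 1 * (e / 8)"
        using Ia(1)[of y] e a by (intro mult_mono) auto
      then have "(1 - e) * (I y / a) \<le> 1" using e by linarith
      then show ?thesis using False by (simp add: U_def)
    qed (simp add: U_def)
  qed
  have U_le: "U y \<le> I y / a" if "R \<le> y" for y
    using that mult_right_mono[of "1 - e" 1 "I y / a"] e a by (simp add: U_def)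
  have step: "U y + e / 4 * T y \<le> expectation (\<lambda>v. U (y - (v - a)))" if y: "R \<le> y" for y
  proof -
    let ?c = "(1 - e) / a"
    \<comment> \<open>For \<open>v \<le> y\<close> this is \<open>1 - e\<close> times the tangent of
      \<open>I / a\<close> at \<open>y\<close>, and for \<open>v > y\<close> it is 1; written as a
      sum, it has an explicit expectation.\<close>
    let ?h = "\<lambda>v. ?c * (I y - a * T y) + (?c * T y) * v - (?c * T y) * (v * indicator {y<..} v)
       + (1 - ?c * (I y - a * T y)) * indicator {y<..} v"
    have c: "0 \<le> ?c" using e a by simp
    have pointwise: "?h v \<le> U (y - (v - a))" for v
    proof (cases "y < v")
      case True
      \<comment> \<open>A jump larger than \<open>y\<close> lands at a distance below
        \<open>a\<close>, and \<open>a \<le> 1 \<le> R\<close>.\<close>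
      then have "y - (v - a) < R" using a R by linarith
      then show ?thesis using True by (simp add: U_def)
    next
      case False
      have *: "?h v = (1 - e) * ((I y + (v - a) * T y) / a)"
        using False by (simp add: algebra_simps add_divide_distrib diff_divide_distrib)
      show ?thesis
      proof (cases "y - (v - a) < R")
        case True
        \<comment> \<open>In the zone where \<open>U\<close> is 1 the tangent must not exceed 1,
          which follows from the two bounds \<open>Ia\<close>.\<close>
        have "(v - a) * T y \<le> y * T y" using False a by (intro mult_right_mono) auto
        then have "(I y + (v - a) * T y) / a \<le> I y / a + y * T y / a"
          using a by (simp add: add_divide_distrib divide_right_mono)
        also have "\<dots> \<le> 1" using Ia[OF y] e by linarith
        finally have "(1 - e) * ((I y + (v - a) * T y) / a) \<le> (1 - e) * 1"
          using e by (intro mult_left_mono) auto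
        then show ?thesis unfolding * using True e by (simp add: U_def)
      next
        case False
        then show ?thesis unfolding * U_def using I_tangent[of y "v - a"] e a
          by (auto intro!: mult_left_mono divide_right_mono)
      qed
    qed
    have int1: "integrable F (\<lambda>v. v * indicator {y<..} v)"
      by (rule Bochner_Integration.integrable_bound[OF integrable_id]) (auto simp: indicator_def)
    have "expectation ?h \<le> expectation (\<lambda>v. U (y - (v - a)))"
      by (intro integral_mono pointwise Bochner_Integration.integrable_add Bochner_Integration.integrable_diff
          integrable_mult_right integrable_id int1 integrable_indicator_real integrable_const
          integrable_const_bound[where B=1, of "\<lambda>v. U (y - (v - a))"])
        (auto simp: U01)
    also have "expectation ?h = ?c * (I y - a * T y) - (?c * T y) * (y * T y + I y) + (1 - ?c * (I y - a * T y)) * T y"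
      using int1 integrable_id mean_zero integral_tail_eq[of y] by (simp add: T_def prob_space[simplified])
    finally have le: "?c * (I y - a * T y) - (?c * T y) * (y * T y + I y) + (1 - ?c * (I y - a * T y)) * T y
        \<le> expectation (\<lambda>v. U (y - (v - a)))" .
    define i where "i = I y / a"
    define j where "j = y * T y / a"
    have ij: "I y = a * i" "y * T y = a * j" using a by (simp_all add: i_def j_def)
    have "?c * (I y - a * T y) - (?c * T y) * (y * T y + I y) + (1 - ?c * (I y - a * T y)) * T y
        = (1 - e) * i + T y * (1 - (1 - e) * (1 + j + 2 * i) + (1 - e) * T y)"
      unfolding ij using a by (simp add: field_simps)
    \<comment> \<open>Here \<open>j\<close> and \<open>2 * i\<close> are at most
      \<open>e / 4\<close> each, so the margin from the factor \<open>1 - e\<close> covers the costs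
      and leaves the gain used as \<open>V\<close>.\<close>
    moreover have "T y * (e / 4) \<le> T y * (1 - (1 - e) * (1 + j + 2 * i) + (1 - e) * T y)"
    proof (intro mult_left_mono)
      have "(1 - e) * (1 + j + 2 * i) \<le> (1 - e) * (1 + e / 2)"
        using Ia[OF y, folded i_def j_def] e by (intro mult_left_mono) auto
      also have "\<dots> \<le> 1 - e / 2" using e zero_le_power2[of e] by (simp add: field_simps)
      moreover have "0 \<le> (1 - e) * T y" using e by simp
      ultimately show "e / 4 \<le> 1 - (1 - e) * (1 + j + 2 * i) + (1 - e) * T y" using e by linarith
    qed simp
    moreover have "U y = (1 - e) * i" using y by (simp add: U_def i_def)
    ultimately show ?thesis using le by (simp add: mult.commute)
  qed
  have "U (x + R - 0) \<le> measure P {\<omega> \<in> space P. walk_max \<xi> \<omega> > ereal x}"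
  proof (rule P.prob_walk_max_ge_subharmonic[where W = "\<lambda>s. U (x + R - s)" and V = "\<lambda>s. e / 4 * T (x + R - s)"])
    fix s assume s: "s \<le> x"
    have "(\<integral>t. U (x + R - (s + t)) \<partial>distr F borel (\<lambda>u. u - a)) = expectation (\<lambda>v. U (x + R - (s + (v - a))))"
      by (rule integral_shifted) measurable
    also have "\<dots> = expectation (\<lambda>v. U (x + R - s - (v - a)))" by (simp add: algebra_simps)
    also have "\<dots> \<ge> U (x + R - s) + e / 4 * T (x + R - s)" using s by (intro step) auto
    finally show "U (x + R - s) + e / 4 * T (x + R - s) \<le> (\<integral>t. U (x + R - (s + t)) \<partial>distr F borel (\<lambda>u. u - a))" .
  next
    fix e' :: real assume "e' > 0"
    then have "\<forall>\<^sub>F t in at_top. I t < e' * a" using order_tendstoD(2)[OF I_tendsto_0, of "e' * a"] a by simp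
    then obtain t where t: "I t < e' * a" by (auto simp: eventually_at_top_linorder)
    \<comment> \<open>Beyond distance \<open>t\<close> the function \<open>U\<close> is below
      \<open>e'\<close>; nearer than \<open>t\<close>, \<open>T\<close> is at least
      \<open>T t\<close>, and this \<open>B\<close> lifts the gain to at least 1.\<close>
    define B where "B = 4 / (e * T t)"
    have "B > 0" using e T_pos[of t] by (simp add: B_def)
    moreover have "U (x + R - s) \<le> e' + B * (e / 4 * T (x + R - s))" if "s \<le> x" for s
    proof (cases "t \<le> x + R - s")
      case True
      have "U (x + R - s) \<le> I (x + R - s) / a" using that by (intro U_le) auto
      also have "\<dots> \<le> I t / a" using True a by (intro divide_right_mono I_antimono) auto
      also have "\<dots> \<le> e'" using t a by (simp add: pos_divide_le_eq)
      finally show ?thesis using \<open>B > 0\<close> e by (simp add: add_increasing2)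
    next
      case False
      then have "T t \<le> T (x + R - s)" by (intro T_antimono) auto
      then have "1 \<le> B * (e / 4 * T (x + R - s))" using e T_pos[of t] by (simp add: B_def)
      then show ?thesis using U01(2)[of "x + R - s"] \<open>e' > 0\<close> by linarith
    qed
    ultimately show "\<exists>B\<ge>0. \<forall>s\<le>x. U (x + R - s) \<le> e' + B * (e / 4 * T (x + R - s))"
      by (intro exI[of _ B]) auto
  next
    show "e / 4 * T (x + R - s) \<le> 1" for s
      using mult_mono[of "e / 4" 1 "T (x + R - s)" 1] e T_le_1 by simp
  qed (use U01 e in auto)
  then show ?thesis using x by (simp add: U_def)
qed

section \<open>The asymptotics\<close>

text \<open>The drift relation matches \<open>a\<close> with \<open>c a * T (c a)\<close>, so
  \<open>I (k * c a) / a\<close> tends to \<open>k powr (1 - r) / (r - 1)\<close>. This is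
  arbitrarily small for large \<open>k\<close>, and \<open>\<theta> * x a\<close> eventually exceeds
  every multiple of \<open>c a\<close>.\<close>

lemma I_scaled_over_drift_tendsto_0:
  assumes A: "filterlim c at_top A" and drift: "((\<lambda>a. c a * T (c a) / a) \<longlongrightarrow> 1) A"
    and pos: "\<forall>\<^sub>F a in A. (0::real) < a" and far: "\<And>k. \<forall>\<^sub>F a in A. k * c a \<le> x a" and \<theta>: "\<theta> > 0"
  shows "((\<lambda>a. I (\<theta> * x a) / a) \<longlongrightarrow> 0) A"
proof (rule tendstoI)
  fix e :: real assume "e > 0"
  have "((\<lambda>k. k powr (1 - r) / (r - 1)) \<longlongrightarrow> 0) at_top" using r_gt_1 by real_asymp
  from eventually_conj[OF order_tendstoD(2)[OF this \<open>e > 0\<close>] eventually_gt_at_top[of 0]]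
  obtain k where k: "k > 0" "k powr (1 - r) / (r - 1) < e"
    by (auto simp: eventually_at_top_linorder)
  have "((\<lambda>a. I (k * c a) / (c a * T (c a)) * (c a * T (c a) / a)) \<longlongrightarrow> k powr (1 - r) / (r - 1) * 1) A"
    by (intro tendsto_mult drift filterlim_compose[OF I_ratio[OF k(1)] A])
  then have "\<forall>\<^sub>F a in A. I (k * c a) / (c a * T (c a)) * (c a * T (c a) / a) < e"
    using k(2) by (intro order_tendstoD) auto
  moreover have "\<forall>\<^sub>F a in A. 0 < c a" using A by (simp add: filterlim_at_top_dense)
  ultimately show "\<forall>\<^sub>F a in A. dist (I (\<theta> * x a) / a) 0 < e"
    using pos far[of "k / \<theta>"]
  proof eventually_elim
    case (elim a)
    have "k * c a \<le> \<theta> * x a" using elim(4) \<theta> by (simp add: field_simps)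
    then have "I (\<theta> * x a) / a \<le> I (k * c a) / a" using elim(3) by (intro divide_right_mono I_antimono) auto
    also have "\<dots> < e" using elim(1,2) T_pos[of "c a"] by simp
    finally show ?case using elim(3) by simp
  qed
qed

text \<open>By \<open>I_q\<close> the target \<open>q\<close> is asymptotic to
  \<open>I (x a) / a\<close>. In the upper bound the quadratic term is negligible since
  \<open>I (x a) / a\<close> tends to 0; in the lower bound \<open>R\<close> is a small fraction of
  \<open>x a\<close>, which costs only a factor near 1.\<close>

lemma walk_max_asymp:
  fixes P :: "real \<Rightarrow> 'w measure"
  assumes walk: "\<And>a. a > 0 \<Longrightarrow> walk_with_step_law (P a) (\<xi> a) (distr F borel (\<lambda>u. u - a))"
    and x: "filterlim x at_top (at_right 0)"
    and small: "\<And>\<theta>. \<theta> > 0 \<Longrightarrow> ((\<lambda>a. I (\<theta> * x a) / a) \<longlongrightarrow> 0) (at_right 0)"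
  shows "(\<lambda>a. measure (P a) {\<omega> \<in> space (P a). walk_max (\<xi> a) \<omega> > ereal (x a)})
           \<sim>[at_right 0] (\<lambda>a. x a * T (x a) / ((r - 1) * a))"
proof (rule asymp_equivI', rule order_tendstoI)
  let ?A = "at_right (0::real)"
  define p where "p a = measure (P a) {\<omega> \<in> space (P a). walk_max (\<xi> a) \<omega> > ereal (x a)}" for a
  define q where "q a = x a * T (x a) / ((r - 1) * a)" for a
  have x_pos: "\<forall>\<^sub>F a in ?A. 0 < x a" using x by (simp add: filterlim_at_top_dense)
  have a_pos: "\<forall>\<^sub>F a in ?A. 0 < a" by (rule eventually_at_right_less)
  have q_pos: "\<forall>\<^sub>F a in ?A. 0 < q a" using x_pos a_pos
    by eventually_elim (use r_gt_1 T_pos in \<open>simp add: q_def\<close>)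
  have I_q: "((\<lambda>a. I (s * x a) / a / q a) \<longlongrightarrow> s powr (1 - r)) ?A" if "s > 0" for s
  proof -
    have "((\<lambda>a. (r - 1) * (I (s * x a) / (x a * T (x a)))) \<longlongrightarrow> (r - 1) * (s powr (1 - r) / (r - 1))) ?A"
      by (intro tendsto_mult tendsto_const filterlim_compose[OF I_ratio[OF that] x])
    moreover have "\<forall>\<^sub>F a in ?A. (r - 1) * (I (s * x a) / (x a * T (x a))) = I (s * x a) / a / q a"
      using a_pos by eventually_elim (simp add: q_def)
    ultimately show ?thesis using r_gt_1 by (auto dest: Lim_transform_eventually)
  qed
  {
    fix b :: real assume "1 < b"
    define e where "e = min 1 ((b - 1) / 2)"
    have e: "0 < e" "e \<le> 1" "1 + e < b" using \<open>1 < b\<close> by (auto simp: e_def min_def field_simps)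
    obtain C a0 where C: "C \<ge> 0" "a0 > 0" and upper: "\<And>a. 0 < a \<Longrightarrow> a < a0 \<Longrightarrow>
        p a \<le> (1 + e) * (I (x a) / a) + C * (I (x a) / a)\<^sup>2"
      using prob_walk_max_le[where 'w = 'w, OF e(1,2)] walk unfolding p_def by blast
    have "((\<lambda>a. (1 + e) * (I (1 * x a) / a / q a) + C * (I (1 * x a) / a / q a) * (I (1 * x a) / a)) \<longlongrightarrow>
        (1 + e) * 1 powr (1 - r) + C * 1 powr (1 - r) * 0) ?A"
      by (intro tendsto_intros I_q small) auto
    from order_tendstoD(2)[OF this, of b] e(3)
    have "\<forall>\<^sub>F a in ?A. (1 + e) * (I (x a) / a / q a) + C * (I (x a) / a / q a) * (I (x a) / a) < b" by simp
    moreover have "\<forall>\<^sub>F a in ?A. 0 < a \<and> a < a0"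
      using C(2) unfolding eventually_at_right_field by blast
    ultimately show "\<forall>\<^sub>F a in ?A. p a / q a < b"
      using q_pos
    proof eventually_elim
      case (elim a)
      have "p a / q a \<le> ((1 + e) * (I (x a) / a) + C * (I (x a) / a)\<^sup>2) / q a"
        using upper[of a] elim by (intro divide_right_mono) auto
      also have "\<dots> = (1 + e) * (I (x a) / a / q a) + C * (I (x a) / a / q a) * (I (x a) / a)"
        by (simp add: add_divide_distrib power2_eq_square mult_ac)
      finally show ?case using elim(1) by simp
    qed
  }
  {
    fix b :: real assume "b < 1"
    define e where "e = min 1 ((1 - b) / 4)"
    have e: "0 < e" "e \<le> 1" "b < (1 - e) * (1 - e)"
    proof -
      show "0 < e" "e \<le> 1" using \<open>b < 1\<close> by (auto simp: e_def)
      have "b \<le> 1 - 4 * e" by (simp add: e_def min_def field_simps)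
      then show "b < (1 - e) * (1 - e)" using \<open>0 < e\<close> mult_pos_pos[OF \<open>0 < e\<close> \<open>0 < e\<close>]
        unfolding left_diff_distrib right_diff_distrib by linarith
    qed
    \<comment> \<open>The fraction \<open>d\<close> fixes the shift \<open>R = d * x a\<close>:
      raising the level to \<open>(1 + d) * x a\<close> changes the limit by the factor
      \<open>(1 + d) powr (1 - r)\<close>, kept above \<open>1 - e\<close>.\<close>
    have "((\<lambda>d. (1 + d) powr (1 - r)) \<longlongrightarrow> 1) (at_right 0)" by real_asymp
    then have "\<forall>\<^sub>F d in at_right 0. 1 - e < (1 + d) powr (1 - r)"
      using e by (intro order_tendstoD) auto
    from eventually_happens'[OF trivial_limit_at_right_real eventually_conj[OF this eventually_at_right_less]]
    obtain d where d: "d > 0" "1 - e < (1 + d) powr (1 - r)" by auto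
    have "((\<lambda>a. (1 - e) * (I ((1 + d) * x a) / a / q a)) \<longlongrightarrow> (1 - e) * (1 + d) powr (1 - r)) ?A"
      using d by (intro tendsto_intros I_q) auto
    moreover have "b < (1 - e) * (1 + d) powr (1 - r)"
      using e(3) mult_left_mono[of "1 - e" "(1 + d) powr (1 - r)" "1 - e"] e d by linarith
    ultimately have "\<forall>\<^sub>F a in ?A. b < (1 - e) * (I ((1 + d) * x a) / a / q a)"
      by (rule order_tendstoD)
    moreover have "\<forall>\<^sub>F a in ?A. I (d / 2 * x a) / a < e / 8"
      using small[of "d / 2"] d e by (intro order_tendstoD) auto
    moreover have "\<forall>\<^sub>F a in ?A. 1 / d \<le> x a" using x by (simp add: filterlim_at_top)
    moreover have "\<forall>\<^sub>F a in ?A. 0 < a \<and> a < (1::real)"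
      unfolding eventually_at_right_field by (rule exI[of _ 1]) auto
    ultimately show "\<forall>\<^sub>F a in ?A. b < p a / q a"
      using q_pos x_pos
    proof eventually_elim
      case (elim a)
      have "(1 - e) * (I (x a + d * x a) / a) \<le> p a"
        unfolding p_def
      proof (rule prob_walk_max_ge[OF e(1,2) _ _ _ _ walk])
        show "1 \<le> d * x a" using elim d by (simp add: field_simps)
        show "I (d * x a / 2) \<le> e / 8 * a" using elim by (simp add: field_simps)
      qed (use elim in auto)
      then have "(1 - e) * (I (x a + d * x a) / a) / q a \<le> p a / q a"
        using elim by (intro divide_right_mono) auto
      then show ?case using elim(1) by (simp add: algebra_simps)
    qed
  }
qed

end

section \<open>Passage from the random variables to their laws\<close>

lemma iid_copies_imp_walk_with_step_law:
  assumes "iid_copies P \<xi> N (\<lambda>\<omega>. X \<omega> - a)" and [measurable]: "X \<in> borel_measurable N"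
  shows "walk_with_step_law P \<xi> (distr (distr N borel X) borel (\<lambda>u. u - a))"
proof -
  have "distr N borel (\<lambda>\<omega>. X \<omega> - a) = distr (distr N borel X) borel (\<lambda>u. u - a)"
    by (subst distr_distr) (auto simp: comp_def)
  with assms(1) show ?thesis
    unfolding iid_copies_def walk_with_step_law_def walk_with_step_law_axioms_def by auto
qed

lemma regularly_varying_law_distr:
  fixes X :: "'v \<Rightarrow> real"
  assumes "prob_space N" and int: "integrable N X" and mean: "integral\<^sup>L N X = 0"
    and neg: "integrable N (\<lambda>\<omega>. (min 0 (X \<omega>))\<^sup>2)" and r: "1 < r" "r < 2"
    and L: "slowly_varying L"
    and tail: "\<And>u. u > 0 \<Longrightarrow> measure N {\<omega> \<in> space N. X \<omega> > u} = u powr (-r) * L u"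
  shows "regularly_varying_law (distr N borel X) r"
    and "\<And>u. u > 0 \<Longrightarrow> measure (distr N borel X) {u<..} = u powr (- r) * L u"
proof -
  interpret N: prob_space N by fact
  have [measurable]: "X \<in> borel_measurable N" using int by auto
  interpret F: prob_space "distr N borel X" by (rule N.prob_space_distr) simp
  have F_tail: "measure (distr N borel X) {u<..} = measure N {\<omega> \<in> space N. X \<omega> > u}" for u
    by (subst measure_distr) (auto intro!: arg_cong[where f = "measure N"])
  show T: "measure (distr N borel X) {u<..} = u powr (- r) * L u" if "u > 0" for u
    unfolding F_tail by (rule tail[OF that])
  obtain A where A: "\<And>u. u \<ge> A \<Longrightarrow> L u > 0" using L by (auto simp: slowly_varying_def)
  show "regularly_varying_law (distr N borel X) r"
  proof
    show "0 < measure (distr N borel X) {u<..}" for u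
    proof -
      \<comment> \<open>Positivity of \<open>L\<close> is known from \<open>A\<close> on and the
        tail formula for positive arguments; monotonicity of the tail carries positivity back to
        \<open>u\<close>.\<close>
      define v where "v = max u (max A 1)"
      have "0 < measure (distr N borel X) {v<..}" using A[of v] by (subst T) (auto simp: v_def)
      also have "\<dots> \<le> measure (distr N borel X) {u<..}" by (rule F.finite_measure_mono) (auto simp: v_def)
      finally show ?thesis .
    qed
    fix t :: real assume t: "t > 0"
    have "((\<lambda>u. t powr (- r) * (L (t * u) / L u)) \<longlongrightarrow> t powr (- r) * 1) at_top"
      using L t by (intro tendsto_mult tendsto_const) (auto simp: slowly_varying_def)
    moreover have "\<forall>\<^sub>F u in at_top. t powr (- r) * (L (t * u) / L u) =
        measure (distr N borel X) {t * u<..} / measure (distr N borel X) {u<..}"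
      using eventually_gt_at_top[of 0]
      by eventually_elim (use t in \<open>simp add: T powr_mult\<close>)
    ultimately show "((\<lambda>u. measure (distr N borel X) {t * u<..} / measure (distr N borel X) {u<..})
        \<longlongrightarrow> t powr (- r)) at_top"
      by (auto dest: Lim_transform_eventually)
  qed (use int mean neg r in \<open>auto simp: integrable_distr_eq integral_distr\<close>)
qed

theorem theorem10:
  fixes N :: "'v measure" and X :: "'v \<Rightarrow> real"
    and P :: "real \<Rightarrow> 'w measure" and \<xi> :: "real \<Rightarrow> nat \<Rightarrow> 'w \<Rightarrow> real"
    and L :: "real \<Rightarrow> real" and r :: real
    and c :: "nat \<Rightarrow> real" and \<nu> :: "real \<Rightarrow> nat"
    and g x :: "real \<Rightarrow> real"
  assumes "prob_space N"
    and "integrable N X" and "integral\<^sup>L N X = 0"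
    and walk: "\<And>a. a > 0 \<Longrightarrow> iid_copies (P a) (\<xi> a) N (\<lambda>\<omega>. X \<omega> - a)"
    and "integrable N (\<lambda>\<omega>. (min 0 (X \<omega>))\<^sup>2)"
    and "1 < r" and "r < 2"
    and "slowly_varying L"
    and tail: "\<And>u. u > 0 \<Longrightarrow> measure N {\<omega> \<in> space N. X \<omega> > u} = u powr (-r) * L u"
    and "\<And>n. n \<ge> 1 \<Longrightarrow> c n > 0"
    and "filterlim c at_top sequentially"
    and "(\<lambda>n. c n powr (-r) * L (c n)) \<sim>[sequentially] (\<lambda>n. 1 / real n)"
    and "\<And>a. a > 0 \<Longrightarrow> \<nu> a \<ge> 1"
    and "filterlim \<nu> at_top (at_right 0)"
    and "(\<lambda>a. a * real (\<nu> a)) \<sim>[at_right 0] (\<lambda>a. c (\<nu> a))"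
    and g: "\<And>a. a > 0 \<Longrightarrow> g a = 1 / c (\<nu> a)"
    and "\<And>a. a > 0 \<Longrightarrow> x a > 0"
    and "Liminf (at_right 0) (\<lambda>a. ereal (g a * x a)) = \<infinity>"
  shows "(\<lambda>a. measure (P a) {\<omega> \<in> space (P a). walk_max (\<xi> a) \<omega> > ereal (x a)})
           \<sim>[at_right 0] (\<lambda>a. x a powr (-r + 1) * L (x a) / ((r - 1) * a))"
proof -
  define F where "F = distr N borel X"
  note law = regularly_varying_law_distr[OF assms(1-3,5-8) tail, folded F_def]
  interpret regularly_varying_law F r by (rule law(1))
  have T_eq: "T u = u powr (- r) * L u" if "u > 0" for u
    using law(2)[of u] that by (simp add: T_def)
  let ?A = "at_right (0::real)"
  have a_pos: "\<forall>\<^sub>F a in ?A. 0 < a" by (rule eventually_at_right_less)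
  have c_lim: "filterlim (\<lambda>a. c (\<nu> a)) at_top ?A"
    by (rule filterlim_compose[OF assms(11,14)])
  have c_pos: "c (\<nu> a) > 0" "\<nu> a \<ge> 1" if "a > 0" for a using assms(10,13) that by auto
  have "(\<lambda>a. c (\<nu> a) powr (-r) * L (c (\<nu> a))) \<sim>[?A] (\<lambda>a. 1 / real (\<nu> a))"
    by (rule asymp_equiv_compose'[OF assms(12,14)])
  \<comment> \<open>Multiplying the relation for \<open>c n powr (- r) * L (c n)\<close> by the one
    between \<open>c n\<close> and \<open>a * n\<close>, at \<open>n = \<nu> a\<close>, shows that
    \<open>c (\<nu> a)\<close> is the scale at which \<open>z * T z\<close> matches the drift
    \<open>a\<close>.\<close>
  then have "(\<lambda>a. c (\<nu> a) powr (-r) * L (c (\<nu> a)) * c (\<nu> a)) \<sim>[?A] (\<lambda>a. 1 / real (\<nu> a) * (a * real (\<nu> a)))"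
    by (intro asymp_equiv_mult asymp_equiv_symI[OF assms(15)])
  moreover have "(\<lambda>a. 1 / real (\<nu> a) * (a * real (\<nu> a))) \<sim>[?A] (\<lambda>a. a)"
    by (rule asymp_equiv_refl_ev, rule eventually_mono[OF a_pos]) (use c_pos(2) in force)
  ultimately have "(\<lambda>a. c (\<nu> a) powr (-r) * L (c (\<nu> a)) * c (\<nu> a)) \<sim>[?A] (\<lambda>a. a)"
    by (rule asymp_equiv_trans)
  then have "((\<lambda>a. c (\<nu> a) powr (-r) * L (c (\<nu> a)) * c (\<nu> a) / a) \<longlongrightarrow> 1) ?A"
    by (rule asymp_equivD_strong) (rule eventually_mono[OF a_pos], simp)
  then have drift: "((\<lambda>a. c (\<nu> a) * T (c (\<nu> a)) / a) \<longlongrightarrow> 1) ?A"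
    by (rule Lim_transform_eventually)
      (rule eventually_mono[OF a_pos], use c_pos in \<open>simp add: T_eq mult_ac\<close>)
  \<comment> \<open>As \<open>g\<close> is the reciprocal of this scale, the infinite lower limit of
    \<open>g a * x a\<close> says that \<open>x a\<close> eventually exceeds every multiple of
    \<open>c (\<nu> a)\<close>.\<close>
  have far: "\<forall>\<^sub>F a in ?A. k * c (\<nu> a) \<le> x a" for k
  proof -
    have "\<forall>\<^sub>F a in ?A. ereal k < ereal (g a * x a)"
      by (rule less_LiminfD) (simp add: assms(18))
    then show ?thesis using a_pos
    proof eventually_elim
      case (elim a)
      then show ?case using c_pos(1)[of a] by (simp add: g field_simps)
    qed
  qed
  have x_lim: "filterlim x at_top ?A"
    by (rule filterlim_at_top_mono[OF c_lim]) (use far[of 1] in simp)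
  have main: "(\<lambda>a. measure (P a) {\<omega> \<in> space (P a). walk_max (\<xi> a) \<omega> > ereal (x a)})
           \<sim>[?A] (\<lambda>a. x a * T (x a) / ((r - 1) * a))"
  proof (rule walk_max_asymp[OF _ x_lim])
    show "walk_with_step_law (P a) (\<xi> a) (distr F borel (\<lambda>u. u - a))" if "a > 0" for a
      unfolding F_def using iid_copies_imp_walk_with_step_law[OF walk[OF that]] assms(2) by auto
    show "((\<lambda>a. I (\<theta> * x a) / a) \<longlongrightarrow> 0) ?A" if "\<theta> > 0" for \<theta>
      by (rule I_scaled_over_drift_tendsto_0[OF c_lim drift a_pos far that])
  qed
  also have "(\<lambda>a. x a * T (x a) / ((r - 1) * a)) \<sim>[?A] (\<lambda>a. x a powr (-r + 1) * L (x a) / ((r - 1) * a))"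
  proof (rule asymp_equiv_refl_ev, rule eventually_mono[OF a_pos])
    fix a :: real assume "0 < a"
    then have "0 < x a" by (rule assms(17))
    then have "x a * T (x a) = x a powr (-r + 1) * L (x a)"
      by (simp add: T_eq powr_mult_base)
    then show "x a * T (x a) / ((r - 1) * a) = x a powr (-r + 1) * L (x a) / ((r - 1) * a)" by simp
  qed
  finally show ?thesis .
qed

end
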